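(* Let $n$ be a positive integer and let $\lambda=(\lambda_1\ge\cdots\ge\lambda_p)$ be a partition with positive parts and $\lambda_1\le n$. Let $v_\mu$ be a $gl(n,\mathbb{C})$-highest weight vector of weight $\mu=(\mu_1\ge\mu_2\ge\cdots\ge\mu_n)$ with $\mu_i\in\mathbb{N}$ for every $i=1,\dots,n$. Then $$\mathbf{K}^\lambda\cdot v_\mu=(-1)^{\lambda_p(\lambda_{p-1}+\cdots+\lambda_1)+\lambda_{p-1}(\lambda_{p-2}+\cdots+\lambda_1)+\cdots+\lambda_2\lambda_1}\left(\prod_{i=1}^{p}(\mu_1-i+\lambda_i)(\mu_2-i+\lambda_i-1)\cdots(\mu_{\lambda_i}-i+1)\right)v_\mu ,$$ where $\mathbf{K}^\lambda\in\mathbf{U}(gl(n))$ is the Capelli-Deruyts bitableau of shape $\lambda$.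
   Context: $\mathbb{N}$ includes $0$. A highest weight vector of weight $\mu$ is a nonzero vector $v$ of a $gl(n)$-module with $e_{i,j}v=0$ for $i<j$ and $e_{i,i}v=\mu_i v$, where $e_{i,j}$ are the elementary matrices. Capelli bitableaux. Let $\mathcal{A}_0=\{\alpha_1,\dots,\alpha_{m}\}$ ($m$ sufficiently large) be a set of virtual symbols, with $|\alpha_s|=0\in\mathbb{Z}_2$, and $\mathcal{L}=\{1,\dots,n\}$ the proper symbols, with $|i|=1\in\mathbb{Z}_2$. Let $gl(m|n)$ be the complex Lie superalgebra with basis $e_{a,b}$, $a,b\in\mathcal{A}_0\cup\mathcal{L}$, of parity $|a|+|b|$, and superbracket $[e_{a,b},e_{c,d}]=\delta_{bc}e_{a,d}-(-1)^{(|a|+|b|)(|c|+|d|)}\delta_{ad}e_{c,b}$. The enveloping algebra $\mathbf{U}(gl(n))$ is the subalgebra of $\mathbf{U}(gl(m|n))$ generated by the $e_{i,j}$, $i,j\in\mathcal{L}$. A product $e_{a_r,b_r}\cdots e_{a_1,b_1}$ is irregular if there are $i\le r$ and $\gamma\in\mathcal{A}_0$ with $\#\{j\le i: b_j=\gamma\}>\#\{j<i: a_j=\gamma\}$. Let $\mathbf{Irr}$ be the left ideal of $\mathbf{U}(gl(m|n))$ generated by the irregular products. It is known that $\mathbf{U}(gl(n))\cap\mathbf{Irr}=0$, that $Virt(m,n)=\mathbf{U}(gl(n))\oplus\mathbf{Irr}$ is a subalgebra, and that $\mathbf{Irr}$ is a two-sided ideal of it; the Capelli devirtualization epimorphism $\mathfrak{p}:Virt(m,n)\to\mathbf{U}(gl(n))$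 is the projection with kernel $\mathbf{Irr}$. For Young tableaux $S=(s_{ij})$, $T=(t_{ij})$ of the same shape $\lambda=(\lambda_1\ge\dots\ge\lambda_p)$ with entries in $\mathcal{L}$, the Capelli bitableau is $$[S|T]=\mathfrak{p}\Big(\prod_{i=1}^{p}\big(e_{s_{i1},\alpha_i}e_{s_{i2},\alpha_i}\cdots e_{s_{i\lambda_i},\alpha_i}\big)\cdot\prod_{i=1}^{p}\big(e_{\alpha_i,t_{i1}}e_{\alpha_i,t_{i2}}\cdots e_{\alpha_i,t_{i\lambda_i}}\big)\Big),$$ with products ordered from left to right by increasing $i$ and $\alpha_1,\dots,\alpha_p$ distinct virtual symbols (the argument lies in $Virt(m,n)$ and the result does not depend on the choice of the $\alpha_i$). The Capelli-Deruyts bitableau $\mathbf{K}^\lambda$ is $[S|T]$ where the $i$-th row of $S$ is $\lambda_i\ \cdots\ 2\ 1$ and the $i$-th row of $T$ is $1\ 2\ \cdots\ \lambda_i$, $i=1,\dots,p$. *)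

theory Defs
  imports "HOL-Analysis.Analysis" "HOL-Library.Poly_Mapping"
begin

section \<open>Free associative algebras\<close>

text \<open>
  With concatenation as addition on words, the convolution product of
  \<open>'x list \<Rightarrow>\<^sub>0 complex\<close> makes this type the free associative unital complex
  algebra on \<open>'x\<close>.
\<close>

instantiation list :: (type) monoid_add
begin
definition zero_list :: "'a list" where "zero_list = []"
definition plus_list :: "'a list \<Rightarrow> 'a list \<Rightarrow> 'a list" where "plus_list xs ys = xs @ ys"
instance by standard (simp_all add: zero_list_def plus_list_def)
end

type_synonym 'x free_alg = "'x list \<Rightarrow>\<^sub>0 complex"

definition free_const :: "complex \<Rightarrow> 'x free_alg" where
  "free_const c = Poly_Mapping.single [] c"

definition free_gen :: "'x \<Rightarrow> 'x free_alg" where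
  "free_gen x = Poly_Mapping.single [x] 1"

inductive_set two_sided_ideal_gen :: "'a::ring_1 set \<Rightarrow> 'a set" for S where
  zero: "0 \<in> two_sided_ideal_gen S"
| gen: "s \<in> S \<Longrightarrow> a * s * b \<in> two_sided_ideal_gen S"
| add: "x \<in> two_sided_ideal_gen S \<Longrightarrow> y \<in> two_sided_ideal_gen S \<Longrightarrow> x + y \<in> two_sided_ideal_gen S"

inductive_set left_ideal_gen :: "'a::ring_1 set \<Rightarrow> 'a set" for S where
  zero: "0 \<in> left_ideal_gen S"
| gen: "s \<in> S \<Longrightarrow> a * s \<in> left_ideal_gen S"
| add: "x \<in> left_ideal_gen S \<Longrightarrow> y \<in> left_ideal_gen S \<Longrightarrow> x + y \<in> left_ideal_gen S"

lemma two_sided_ideal_gen_mult: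
  assumes "x \<in> two_sided_ideal_gen S"
  shows "a * x * b \<in> two_sided_ideal_gen S"
  using assms
proof induction
  case zero
  then show ?case by (simp add: two_sided_ideal_gen.zero)
next
  case (gen s c d)
  have "a * (c * s * d) * b = (a * c) * s * (d * b)" by (simp add: mult.assoc)
  then show ?case using two_sided_ideal_gen.gen[OF gen] by simp
next
  case (add x y)
  then show ?case by (simp add: distrib_left distrib_right two_sided_ideal_gen.add)
qed

lemma two_sided_ideal_gen_uminus:
  "x \<in> two_sided_ideal_gen S \<Longrightarrow> - x \<in> two_sided_ideal_gen S"
  using two_sided_ideal_gen_mult[of x S "- 1" 1] by simp


section \<open>The enveloping algebra of \<open>gl(m|n)\<close>\<close>

text \<open>
  The type \<open>'m\<close> indexes the virtual symbols and \<open>'n\<close> the proper symbols, so that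
  \<open>m = CARD('m)\<close> and \<open>n = CARD('n)\<close>.
\<close>

datatype ('m, 'n) symb = Virt 'm | Prop 'n

fun parity :: "('m, 'n) symb \<Rightarrow> nat" where
  "parity (Virt _) = 0"
| "parity (Prop _) = 1"

type_synonym ('m, 'n) gl_free = "(('m, 'n) symb \<times> ('m, 'n) symb) free_alg"

definition gl_sign :: "('m, 'n) symb \<Rightarrow> ('m, 'n) symb \<Rightarrow> ('m, 'n) symb \<Rightarrow> ('m, 'n) symb \<Rightarrow> complex" where
  "gl_sign a b c d = (- 1) ^ ((parity a + parity b) * (parity c + parity d))"

definition superbracket ::
  "('m, 'n) symb \<Rightarrow> ('m, 'n) symb \<Rightarrow> ('m, 'n) symb \<Rightarrow> ('m, 'n) symb \<Rightarrow> ('m, 'n) gl_free" where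
  "superbracket a b c d =
     (if b = c then free_gen (a, d) else 0)
     - free_const (gl_sign a b c d) * (if a = d then free_gen (c, b) else 0)"

definition env_relations :: "('m, 'n) gl_free set" where
  "env_relations =
     {free_gen (a, b) * free_gen (c, d)
      - free_const (gl_sign a b c d) * free_gen (c, d) * free_gen (a, b)
      - superbracket a b c d | a b c d. True}"

definition env_eq :: "('m, 'n) gl_free \<Rightarrow> ('m, 'n) gl_free \<Rightarrow> bool" where
  "env_eq f g \<longleftrightarrow> f - g \<in> two_sided_ideal_gen env_relations"

lemma equivp_env_eq: "equivp env_eq"
proof (rule equivpI)
  show "reflp env_eq"
    by (simp add: reflp_def env_eq_def two_sided_ideal_gen.zero)
  show "symp env_eq"
    unfolding symp_def env_eq_def using two_sided_ideal_gen_uminus by fastforce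
  show "transp env_eq"
    unfolding transp_def env_eq_def using two_sided_ideal_gen.add by fastforce
qed

quotient_type ('m, 'n) env_gl = "('m, 'n) gl_free" / env_eq
  by (rule equivp_env_eq)

text \<open>The quotient is nontrivial: relations have vanishing constant term.\<close>

lemma lookup_mult_Nil:
  "Poly_Mapping.lookup (f * g :: 'x free_alg) []
     = Poly_Mapping.lookup f [] * Poly_Mapping.lookup g []"
proof -
  have "(\<Sum>q. Poly_Mapping.lookup g q when [] = l + q) = (Poly_Mapping.lookup g [] when l = [])"
    for l :: "'x list"
    by (cases "l = []") (simp_all add: plus_list_def)
  then show ?thesis
    by (simp add: lookup_mult mult_when)
qed

lemma lookup_free_gen_Nil: "Poly_Mapping.lookup (free_gen x) [] = 0"
  by (simp add: free_gen_def lookup_single)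

lemma lookup_env_ideal_Nil:
  assumes "f \<in> two_sided_ideal_gen env_relations"
  shows "Poly_Mapping.lookup f [] = 0"
  using assms
proof induction
  case (gen s a b)
  then have "Poly_Mapping.lookup s [] = 0"
    by (auto simp: env_relations_def superbracket_def lookup_minus lookup_mult_Nil lookup_free_gen_Nil)
  then show ?case by (simp add: lookup_mult_Nil)
qed (simp_all add: lookup_add)

instantiation env_gl :: (type, type) ring_1
begin

lift_definition zero_env_gl :: "('a, 'b) env_gl" is 0 .
lift_definition one_env_gl :: "('a, 'b) env_gl" is 1 .

lift_definition plus_env_gl :: "('a, 'b) env_gl \<Rightarrow> ('a, 'b) env_gl \<Rightarrow> ('a, 'b) env_gl" is "(+)"
  unfolding env_eq_def by (metis add_diff_add two_sided_ideal_gen.add)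

lift_definition uminus_env_gl :: "('a, 'b) env_gl \<Rightarrow> ('a, 'b) env_gl" is uminus
  unfolding env_eq_def using two_sided_ideal_gen_uminus by fastforce

lift_definition minus_env_gl :: "('a, 'b) env_gl \<Rightarrow> ('a, 'b) env_gl \<Rightarrow> ('a, 'b) env_gl" is "(-)"
proof -
  fix f f' g g' :: "('a, 'b) gl_free"
  assume "env_eq f f'" "env_eq g g'"
  then have "(f - f') + - (g - g') \<in> two_sided_ideal_gen env_relations"
    unfolding env_eq_def using two_sided_ideal_gen.add two_sided_ideal_gen_uminus by blast
  then show "env_eq (f - g) (f' - g')"
    unfolding env_eq_def by (simp add: algebra_simps)
qed

lift_definition times_env_gl :: "('a, 'b) env_gl \<Rightarrow> ('a, 'b) env_gl \<Rightarrow> ('a, 'b) env_gl" is "(*)"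
proof -
  fix f f' g g' :: "('a, 'b) gl_free"
  assume "env_eq f f'" "env_eq g g'"
  then have "1 * (f - f') * g + f' * (g - g') * 1 \<in> two_sided_ideal_gen env_relations"
    unfolding env_eq_def using two_sided_ideal_gen.add two_sided_ideal_gen_mult by blast
  then show "env_eq (f * g) (f' * g')"
    unfolding env_eq_def by (simp add: left_diff_distrib right_diff_distrib)
qed

instance
proof
  fix a b c :: "('a, 'b) env_gl"
  have refl: "env_eq f f" for f :: "('a, 'b) gl_free"
    using equivp_env_eq by (rule equivp_reflp)
  show "a + b + c = a + (b + c)" by transfer (simp add: add.assoc refl)
  show "a + b = b + a" by transfer (simp add: add.commute refl)
  show "0 + a = a" by transfer (simp add: refl)
  show "- a + a = 0" by transfer (simp add: refl)
  show "a - b = a + - b" by transfer (simp add: refl)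
  show "a * b * c = a * (b * c)" by transfer (simp add: mult.assoc refl)
  show "1 * a = a" by transfer (simp add: refl)
  show "a * 1 = a" by transfer (simp add: refl)
  show "(a + b) * c = a * c + b * c" by transfer (simp add: distrib_right refl)
  show "a * (b + c) = a * b + a * c" by transfer (simp add: distrib_left refl)
  show "(0 :: ('a, 'b) env_gl) \<noteq> 1"
  proof transfer
    show "\<not> env_eq 0 (1 :: ('a, 'b) gl_free)"
      using lookup_env_ideal_Nil[of "0 - 1 :: ('a, 'b) gl_free"]
      by (auto simp: env_eq_def lookup_one zero_list_def)
  qed
qed

end

lift_definition env_const :: "complex \<Rightarrow> ('m, 'n) env_gl" is free_const .

lift_definition gl_gen :: "('m, 'n) symb \<Rightarrow> ('m, 'n) symb \<Rightarrow> ('m, 'n) env_gl"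
  is "\<lambda>a b. free_gen (a, b)" .


section \<open>Devirtualization and Capelli bitableaux\<close>

text \<open>\<open>U(gl(n))\<close>, as the unital complex subalgebra generated by the \<open>e\<^sub>i\<^sub>j\<close> with proper indices.\<close>

inductive_set proper_env :: "('m, 'n) env_gl set" where
  const: "env_const c \<in> proper_env"
| gen: "gl_gen (Prop i) (Prop j) \<in> proper_env"
| add: "x \<in> proper_env \<Longrightarrow> y \<in> proper_env \<Longrightarrow> x + y \<in> proper_env"
| mult: "x \<in> proper_env \<Longrightarrow> y \<in> proper_env \<Longrightarrow> x * y \<in> proper_env"

definition gl_prod :: "(('m, 'n) symb \<times> ('m, 'n) symb) list \<Rightarrow> ('m, 'n) env_gl" where
  "gl_prod w = prod_list (map (\<lambda>(a, b). gl_gen a b) w)"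

text \<open>
  A product is written \<open>e(a\<^sub>r,b\<^sub>r) \<dots> e(a\<^sub>1,b\<^sub>1)\<close>, so its factors are numbered from the
  right; below, position \<open>i\<close> of the reversed word is the factor number \<open>i + 1\<close>.
\<close>

definition irregular :: "(('m, 'n) symb \<times> ('m, 'n) symb) list \<Rightarrow> bool" where
  "irregular w \<longleftrightarrow>
     (\<exists>i < length w. \<exists>\<gamma>.
        count_list (map snd (take (Suc i) (rev w))) (Virt \<gamma>)
        > count_list (map fst (take i (rev w))) (Virt \<gamma>))"

definition Irr :: "('m, 'n) env_gl set" where
  "Irr = left_ideal_gen (gl_prod ` {w. irregular w})"

text \<open>
  The projection of \<open>U(gl(n)) \<oplus> Irr\<close> onto its first summand; unspecified outside
  this subspace.
\<close>

definition devirt :: "('m, 'n) env_gl \<Rightarrow> ('m, 'n) env_gl" where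
  "devirt x = (THE u. u \<in> proper_env \<and> x - u \<in> Irr)"

text \<open>
  Tableaux are given by their lists of rows. Rows are numbered from \<open>0\<close>, and
  \<open>\<alpha> i\<close> is the virtual symbol attached to row \<open>i\<close>.
\<close>

definition capelli_bitableau :: "(nat \<Rightarrow> 'm) \<Rightarrow> 'n list list \<Rightarrow> 'n list list \<Rightarrow> ('m, 'n) env_gl" where
  "capelli_bitableau \<alpha> S T =
     devirt
       (gl_prod (concat (map (\<lambda>i. map (\<lambda>s. (Prop s, Virt (\<alpha> i))) (S ! i)) [0..<length S]))
        * gl_prod (concat (map (\<lambda>i. map (\<lambda>t. (Virt (\<alpha> i), Prop t)) (T ! i)) [0..<length T])))"

text \<open>The \<open>k\<close>-th proper symbol, for \<open>1 \<le> k \<le> n\<close>.\<close>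

definition proper_sym :: "nat \<Rightarrow> 'n::{finite, linorder}" where
  "proper_sym k = sorted_list_of_set (UNIV :: 'n set) ! (k - 1)"

definition is_partition :: "nat list \<Rightarrow> bool" where
  "is_partition lam \<longleftrightarrow> sorted_wrt (\<ge>) lam \<and> (\<forall>k \<in> set lam. 0 < k)"

definition capelli_deruyts ::
  "(nat \<Rightarrow> 'm) \<Rightarrow> nat list \<Rightarrow> ('m, 'n::{finite, linorder}) env_gl" where
  "capelli_deruyts \<alpha> lam =
     capelli_bitableau \<alpha>
       (map (\<lambda>k. map proper_sym (rev [1..<Suc k])) lam)
       (map (\<lambda>k. map proper_sym [1..<Suc k]) lam)"


section \<open>Modules over \<open>gl(n)\<close>\<close>

definition elem_matrix :: "'n \<Rightarrow> 'n \<Rightarrow> complex^'n^'n::finite" where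
  "elem_matrix i j = (\<chi> a b. if a = i \<and> b = j then 1 else 0)"

locale gl_module = vector_space scl
  for scl :: "complex \<Rightarrow> 'v::ab_group_add \<Rightarrow> 'v" +
  fixes \<rho> :: "complex^'n^'n::finite \<Rightarrow> 'v \<Rightarrow> 'v"
  assumes linear_action: "Vector_Spaces.linear scl scl (\<rho> A)"
    and action_add: "\<rho> (A + B) v = \<rho> A v + \<rho> B v"
    and action_scale: "\<rho> (\<chi> i j. c * A $ i $ j) v = scl c (\<rho> A v)"
    and action_bracket: "\<rho> (A ** B - B ** A) v = \<rho> A (\<rho> B v) - \<rho> B (\<rho> A v)"

definition highest_weight_vector ::
  "(complex \<Rightarrow> 'v::ab_group_add \<Rightarrow> 'v) \<Rightarrow> (complex^'n::{finite, linorder}^'n::{finite, linorder} \<Rightarrow> 'v \<Rightarrow> 'v)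
     \<Rightarrow> ('n \<Rightarrow> complex) \<Rightarrow> 'v \<Rightarrow> bool" where
  "highest_weight_vector scl \<rho> \<mu> v \<longleftrightarrow>
     v \<noteq> 0
     \<and> (\<forall>i j. i < j \<longrightarrow> \<rho> (elem_matrix i j) v = 0)
     \<and> (\<forall>i. \<rho> (elem_matrix i i) v = scl (\<mu> i) v)"

text \<open>
  The algebra homomorphism \<open>U(gl(n)) \<rightarrow> End(V)\<close> extending the action of the Lie algebra:
  its graph is the unital subalgebra of \<open>U(gl(n)) \<times> End(V)\<close> generated by the pairs
  \<open>(e\<^sub>i\<^sub>j, \<rho> e\<^sub>i\<^sub>j)\<close>.
\<close>

inductive env_acts_by ::
  "(complex \<Rightarrow> 'v::ab_group_add \<Rightarrow> 'v) \<Rightarrow> (complex^'n^'n::finite \<Rightarrow> 'v \<Rightarrow> 'v)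
     \<Rightarrow> ('m, 'n) env_gl \<Rightarrow> ('v \<Rightarrow> 'v) \<Rightarrow> bool"
  for scl \<rho> where
  const: "env_acts_by scl \<rho> (env_const c) (scl c)"
| gen: "env_acts_by scl \<rho> (gl_gen (Prop i) (Prop j)) (\<rho> (elem_matrix i j))"
| add: "env_acts_by scl \<rho> x S \<Longrightarrow> env_acts_by scl \<rho> y T
    \<Longrightarrow> env_acts_by scl \<rho> (x + y) (\<lambda>v. S v + T v)"
| mult: "env_acts_by scl \<rho> x S \<Longrightarrow> env_acts_by scl \<rho> y T
    \<Longrightarrow> env_acts_by scl \<rho> (x * y) (S \<circ> T)"

definition env_action ::
  "(complex \<Rightarrow> 'v::ab_group_add \<Rightarrow> 'v) \<Rightarrow> (complex^'n^'n::finite \<Rightarrow> 'v \<Rightarrow> 'v)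
     \<Rightarrow> ('m, 'n) env_gl \<Rightarrow> 'v \<Rightarrow> 'v" where
  "env_action scl \<rho> u = (THE T. env_acts_by scl \<rho> u T)"

end

theory Submission
  imports Defs "HOL-Library.Function_Algebras"
begin

text \<open>
  Write \<open>e(a,b)\<close> for the generators, and call \<open>e(\<alpha>,i)\<close> a creator and \<open>e(i,\<alpha>)\<close> an annihilator if
  \<open>\<alpha>\<close> is virtual and \<open>i\<close> proper. The Capelli--Deruyts bitableau is the devirtualization of
  \<open>C\<^sub>1\<dots>C\<^sub>p D\<^sub>1\<dots>D\<^sub>p\<close>, where \<open>D\<^sub>i\<close> is the row of creators \<open>e(\<alpha>\<^sub>i,1)\<dots>e(\<alpha>\<^sub>i,\<lambda>\<^sub>i)\<close> and \<open>C\<^sub>i\<close> is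
  the row of annihilators \<open>e(\<lambda>\<^sub>i,\<alpha>\<^sub>i)\<dots>e(1,\<alpha>\<^sub>i)\<close>.

  Every \<open>gl(n)\<close>-module \<open>V\<close> sits inside a \<open>gl(m|n)\<close>-module, the exterior algebra on the creators
  tensored with \<open>V\<close>, as the vectors \<open>1 \<otimes> v\<close> (the vacuum vectors). There the elements of \<open>U(gl(n))\<close>
  act as on \<open>V\<close>, and \<open>Irr\<close> acts by \<open>0\<close>: an irregular word asks for more creators carrying some
  virtual symbol than there are. So \<open>K\<^sup>\<lambda> v\<close> can be computed by letting
  \<open>C\<^sub>1\<dots>C\<^sub>p D\<^sub>1\<dots>D\<^sub>p\<close> itself act on the vacuum vector of \<open>v\<close>
  (lemmas \<open>super_rel\<close>, \<open>Irr_vac\<close>, \<open>env_action_vac\<close>).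

  The same module shows that the definitions make sense. Taking \<open>V = U(gl(m|n))\<close> with left
  multiplication, an element \<open>u\<close> of \<open>U(gl(n)) \<inter> Irr\<close> sends the vacuum vector of \<open>1\<close> both to the one of
  \<open>u\<close> and to \<open>0\<close>, so the devirtualization is unique.
  It exists because annihilators can be commuted to the right past the creators
  (lemmas \<open>proper_env_Irr\<close>, \<open>devirt_exists\<close>).

  The eigenvalue is found by peeling off the last row. Moving \<open>D\<^sub>p\<close> to the left of
  \<open>D\<^sub>1\<dots>D\<^sub>p\<^sub>-\<^sub>1\<close> costs the sign \<open>(-1)\<close> to the power \<open>\<lambda>\<^sub>p (\<lambda>\<^sub>1 + \<dots> + \<lambda>\<^sub>p\<^sub>-\<^sub>1)\<close>. The vector
  \<open>w = D\<^sub>1\<dots>D\<^sub>p\<^sub>-\<^sub>1 v\<close> is again a highest weight vector for the indices up to \<open>\<lambda>\<^sub>p\<close>: the bracket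
  with \<open>e(i,j)\<close> replaces \<open>i\<close> by \<open>j\<close> in a row that already contains \<open>j\<close>, which gives \<open>0\<close>, so that
  \<open>e(i,j)\<close> passes all rows and reaches \<open>v\<close>; and each row contains \<open>i\<close> once and so
  lowers the weight \<open>\<mu>\<^sub>i\<close> by \<open>1\<close> (lemma \<open>highest_up_word\<close>). Finally
  \<open>C\<^sub>p D\<^sub>p\<close> acts on a highest weight vector of weight \<open>\<nu>\<close> by \<open>\<Prod>\<^sub>k (\<nu>\<^sub>k + \<lambda>\<^sub>p - k)\<close>: the annihilator
  \<open>e(k,\<alpha>)\<close> meets \<open>e(\<alpha>,k)\<close>, leaving \<open>e(k,k) + e(\<alpha>,\<alpha>)\<close>, which reads off \<open>\<nu>\<^sub>k\<close> and the number
  \<open>\<lambda>\<^sub>p - k\<close> of the creators to its right (lemma \<open>row_contraction\<close>). With \<open>\<nu>\<^sub>k = \<mu>\<^sub>k - (p - 1)\<close> this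
  is the last factor of the product, and \<open>C\<^sub>1\<dots>C\<^sub>p\<^sub>-\<^sub>1 D\<^sub>1\<dots>D\<^sub>p\<^sub>-\<^sub>1 v\<close> remains.
\<close>

section \<open>The ring of additive maps\<close>

text \<open>
  Packing additive maps into a type makes operator identities ring identities. The trivial group is
  allowed, so \<open>0 = 1\<close> is possible and the instance stops short of a unital ring class.
\<close>

typedef (overloaded) 'a endo = "{T :: 'a::ab_group_add \<Rightarrow> 'a. \<forall>x y. T (x + y) = T x + T y}"
  morphisms app Endo
  by (rule exI[of _ id]) simp

setup_lifting type_definition_endo

lemma app_add: "app T (x + y) = app T x + app T y"
  using app[of T] by simp

lemma app_zero [simp]: "app T 0 = 0"
  using app_add[of T 0 0] by simp

lemma app_minus [simp]: "app T (- x) = - app T x"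
  using app_add[of T x "- x"] by (simp add: eq_neg_iff_add_eq_0 add.commute)

instantiation endo :: (ab_group_add) "{ring, monoid_mult}"
begin

lift_definition zero_endo :: "'a endo" is "\<lambda>_. 0" by simp
lift_definition one_endo :: "'a endo" is "\<lambda>x. x" by simp
lift_definition plus_endo :: "'a endo \<Rightarrow> 'a endo \<Rightarrow> 'a endo" is "\<lambda>S T x. S x + T x"
  by (simp add: algebra_simps)
lift_definition uminus_endo :: "'a endo \<Rightarrow> 'a endo" is "\<lambda>T x. - T x"
  by simp
lift_definition minus_endo :: "'a endo \<Rightarrow> 'a endo \<Rightarrow> 'a endo" is "\<lambda>S T x. S x - T x"
  by (simp add: algebra_simps)
lift_definition times_endo :: "'a endo \<Rightarrow> 'a endo \<Rightarrow> 'a endo" is "\<lambda>S T x. S (T x)"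
  by simp

instance
  by standard (transfer; force simp: algebra_simps)+

end

lemma endo_eqI: "(\<And>x. app S x = app T x) \<Longrightarrow> S = T"
  by transfer auto

lemma app_arith [simp]:
  "app 0 x = 0" "app 1 x = x" "app (S + T) x = app S x + app T x" "app (- S) x = - app S x"
  "app (S - T) x = app S x - app T x" "app (S * T) x = app S (app T x)"
  by (transfer; simp)+

lemma app_sum: "app (sum S I) x = (\<Sum>i\<in>I. app (S i) x)"
  by (induction I rule: infinite_finite_induct) auto

section \<open>Generators and relations of \<open>U(gl(m|n))\<close>\<close>

lemma env_const_add: "env_const (a + b) = (env_const a + env_const b :: ('m, 'n) env_gl)"
  by transfer (simp add: free_const_def single_add equivp_reflp[OF equivp_env_eq])

lemma env_const_mult: "env_const (a * b) = (env_const a * env_const b :: ('m, 'n) env_gl)"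
proof -
  have "free_const (a * b) = (free_const a * free_const b :: ('m, 'n) gl_free)"
    by (simp add: free_const_def mult_single plus_list_def)
  then show ?thesis by transfer (simp add: equivp_reflp[OF equivp_env_eq])
qed

lemma env_const_1 [simp]: "env_const 1 = (1 :: ('m, 'n) env_gl)"
proof -
  have "free_const 1 = (1 :: ('m, 'n) gl_free)"
    by (simp add: free_const_def single_one flip: zero_list_def)
  then show ?thesis by transfer (simp add: equivp_reflp[OF equivp_env_eq])
qed

lemma env_const_0 [simp]: "env_const 0 = (0 :: ('m, 'n) env_gl)"
  using env_const_add[of 0 0] by simp

lemma env_const_uminus: "env_const (- a) = - (env_const a :: ('m, 'n) env_gl)"
  using env_const_add[of a "- a"] by (simp add: eq_neg_iff_add_eq_0 add.commute)

lemma env_const_diff: "env_const (a - b) = env_const a - (env_const b :: ('m, 'n) env_gl)"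
  using env_const_add[of a "- b"] by (simp add: env_const_uminus)

lemma env_const_of_nat: "env_const (of_nat k) = (of_nat k :: ('m, 'n) env_gl)"
  by (induction k) (auto simp: env_const_add)

lemma env_const_power: "env_const (a ^ k) = (env_const a :: ('m, 'n) env_gl) ^ k"
  by (induction k) (auto simp: env_const_mult)

lemma poly_mapping_additive_induct [case_names zero single add]:
  assumes "P 0" "\<And>w c. P (Poly_Mapping.single w c)" "\<And>f g. P f \<Longrightarrow> P g \<Longrightarrow> P (f + g)"
  shows "P (f :: 'x \<Rightarrow>\<^sub>0 'y::comm_monoid_add)"
proof -
  have "P (\<Sum>w\<in>W. Poly_Mapping.single w (h w))" for W and h :: "'x \<Rightarrow> 'y"
    by (induction W rule: infinite_finite_induct) (auto intro: assms)
  moreover have "f = (\<Sum>w\<in>Poly_Mapping.keys f. Poly_Mapping.single w (Poly_Mapping.lookup f w))"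
    by (rule poly_mapping_eqI)
      (auto simp: lookup_sum lookup_single when_def in_keys_iff sum.delta)
  ultimately show ?thesis by metis
qed

text \<open>
  Constants commute with words of the free algebra, and words span it.
\<close>

lemma env_const_central: "env_const c * x = x * (env_const c :: ('m, 'n) env_gl)"
proof -
  have *: "free_const c * f = f * (free_const c :: ('m, 'n) gl_free)" for c f
  proof (induction f rule: poly_mapping_additive_induct)
    case (single w b)
    then show ?case by (simp add: free_const_def mult_single plus_list_def mult.commute)
  qed (auto simp: algebra_simps)
  show ?thesis by transfer (subst *, rule equivp_reflp[OF equivp_env_eq])
qed

lemma gl_gen_commute:
  "gl_gen a b * gl_gen c d =
     env_const (gl_sign a b c d) * gl_gen c d * gl_gen a b
     + (if b = c then gl_gen a d else 0)
     - env_const (gl_sign a b c d) * (if a = d then gl_gen c b else 0 :: ('m, 'n) env_gl)"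
proof -
  have "gl_gen a b * gl_gen c d - env_const (gl_sign a b c d) * gl_gen c d * gl_gen a b =
     (if b = c then gl_gen a d else 0)
     - env_const (gl_sign a b c d) * (if a = d then gl_gen c b else 0 :: ('m, 'n) env_gl)"
  proof -
    have "env_eq (free_gen (a, b) * free_gen (c, d)
        - free_const (gl_sign a b c d) * free_gen (c, d) * free_gen (a, b))
        (superbracket a b c d :: ('m, 'n) gl_free)"
      unfolding env_eq_def
      using two_sided_ideal_gen.gen[of _ env_relations 1 1] by (fastforce simp: env_relations_def)
    then have "abs_env_gl (free_gen (a, b) * free_gen (c, d)
        - free_const (gl_sign a b c d) * free_gen (c, d) * free_gen (a, b)) =
        (abs_env_gl (superbracket a b c d :: ('m, 'n) gl_free))"
      by (simp add: env_gl.abs_eq_iff)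
    then show ?thesis
      by (cases "b = c"; cases "a = d") (simp_all add: superbracket_def gl_gen.abs_eq env_const.abs_eq
        times_env_gl.abs_eq minus_env_gl.abs_eq plus_env_gl.abs_eq zero_env_gl.abs_eq)
  qed
  then show ?thesis by (simp add: algebra_simps)
qed

text \<open>
  An image of the generators in any ring extends to \<open>U(gl(m|n))\<close> as soon as it satisfies the
  defining relations. The scalars enter through a map \<open>scal\<close> because the target is only a ring.
\<close>

locale env_representation =
  fixes scal :: "complex \<Rightarrow> 'r::{ring, monoid_mult}"
    and E :: "('m, 'n) symb \<Rightarrow> ('m, 'n) symb \<Rightarrow> 'r"
  assumes scal_add: "scal (y + z) = scal y + scal z"
    and scal_mult: "scal (y * z) = scal y * scal z"
    and scal_1: "scal 1 = 1"
    and scal_E: "scal z * E a b = E a b * scal z"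
    and E_commute: "E a b * E c d =
      scal (gl_sign a b c d) * E c d * E a b
      + (if b = c then E a d else 0) - scal (gl_sign a b c d) * (if a = d then E c b else 0)"
begin

lemma scal_0: "scal 0 = 0"
  using scal_add[of 0 0] by simp

definition word_val :: "(('m, 'n) symb \<times> ('m, 'n) symb) list \<Rightarrow> 'r" where
  "word_val w = prod_list (map (\<lambda>(a, b). E a b) w)"

definition free_val :: "('m, 'n) gl_free \<Rightarrow> 'r" where
  "free_val f = (\<Sum>w\<in>Poly_Mapping.keys f. scal (Poly_Mapping.lookup f w) * word_val w)"

lemma scal_word_val: "scal z * word_val w = word_val w * scal z"
proof (induction w)
  case (Cons p w)
  obtain a b where p: "p = (a, b)" by force
  have "scal z * (E a b * word_val w) = E a b * (scal z * word_val w)"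
    by (metis mult.assoc scal_E)
  also have "\<dots> = (E a b * word_val w) * scal z" by (simp add: Cons mult.assoc)
  finally show ?case by (simp add: word_val_def p)
qed (simp add: word_val_def)

lemma free_val_superset:
  assumes "finite W" "Poly_Mapping.keys f \<subseteq> W"
  shows "free_val f = (\<Sum>w\<in>W. scal (Poly_Mapping.lookup f w) * word_val w)"
  unfolding free_val_def
  by (rule sum.mono_neutral_left) (use assms in \<open>auto simp: in_keys_iff scal_0\<close>)

lemma free_val_add: "free_val (f + g) = free_val f + free_val g"
proof -
  let ?W = "Poly_Mapping.keys f \<union> Poly_Mapping.keys g"
  have "finite ?W" "Poly_Mapping.keys (f + g) \<subseteq> ?W"
    by (auto simp: in_keys_iff lookup_add)
  then show ?thesis
    by (simp add: free_val_superset[of ?W] lookup_add scal_add distrib_right sum.distrib)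
qed

lemma free_val_single: "free_val (Poly_Mapping.single w z) = scal z * word_val w"
  by (cases "z = 0") (simp_all add: free_val_def scal_0)

lemma free_val_0: "free_val 0 = 0"
  by (simp add: free_val_def)

lemma free_val_uminus: "free_val (- f) = - free_val f"
  using free_val_add[of f "- f"] by (simp add: eq_neg_iff_add_eq_0 add.commute free_val_0)

text \<open>
  Both sides are biadditive, so it is enough to compare them on multiples of words.
\<close>

lemma free_val_mult: "free_val (f * g) = free_val f * free_val g"
proof (induction f rule: poly_mapping_additive_induct)
  case (single w y)
  show ?case
  proof (induction g rule: poly_mapping_additive_induct)
    case (single w' z)
    have "scal (y * z) * word_val (w @ w') = scal y * (scal z * word_val w) * word_val w'"
      by (simp add: scal_mult word_val_def mult.assoc)
    also have "\<dots> = (scal y * word_val w) * (scal z * word_val w')"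
      unfolding scal_word_val[of z w] by (simp add: mult.assoc)
    finally show ?case
      by (simp add: mult_single plus_list_def free_val_single)
  qed (auto simp: free_val_add free_val_0 distrib_left)
qed (auto simp: free_val_add free_val_0 distrib_right)

lemma free_val_gen: "free_val (free_gen (a, b)) = E a b"
  by (simp add: free_gen_def free_val_single scal_1 word_val_def)

lemma free_val_const: "free_val (free_const z) = scal z"
  by (simp add: free_const_def free_val_single word_val_def)

lemma free_val_relations:
  assumes "f \<in> two_sided_ideal_gen env_relations"
  shows "free_val f = 0"
  using assms
proof induction
  case (gen s x y)
  then obtain a b c d where s: "s = free_gen (a, b) * free_gen (c, d)
      - free_const (gl_sign a b c d) * free_gen (c, d) * free_gen (a, b) - superbracket a b c d"
    by (auto simp: env_relations_def)
  have "free_val s = 0"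
    unfolding s superbracket_def diff_conv_add_uminus free_val_add free_val_uminus free_val_mult
      free_val_gen free_val_const E_commute[of a b c d]
    by (auto simp: free_val_0 free_val_gen)
  then show ?case by (simp add: free_val_mult)
qed (auto simp: free_val_0 free_val_add)

definition env_val :: "('m, 'n) env_gl \<Rightarrow> 'r" where
  "env_val x = free_val (rep_env_gl x)"

lemma env_val_abs: "env_val (abs_env_gl f) = free_val f"
proof -
  have "env_eq (rep_env_gl (abs_env_gl f)) f"
    by (metis Quotient3_env_gl Quotient3_def equivp_env_eq equivp_reflp rep_abs_rsp_left)
  then have "free_val (rep_env_gl (abs_env_gl f) - f) = 0"
    by (simp add: env_eq_def free_val_relations)
  then show ?thesis
    unfolding env_val_def diff_conv_add_uminus free_val_add free_val_uminus by simp
qed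

lemma env_val_add: "env_val (x + y) = env_val x + env_val y"
  by (induction x rule: env_gl.abs_induct, induction y rule: env_gl.abs_induct)
    (simp add: plus_env_gl.abs_eq env_val_abs free_val_add)

lemma env_val_mult: "env_val (x * y) = env_val x * env_val y"
  by (induction x rule: env_gl.abs_induct, induction y rule: env_gl.abs_induct)
    (simp add: times_env_gl.abs_eq env_val_abs free_val_mult)

lemma env_val_gen: "env_val (gl_gen a b) = E a b"
  by (simp add: gl_gen.abs_eq env_val_abs free_val_gen)

lemma env_val_const: "env_val (env_const z) = scal z"
  by (simp add: env_const.abs_eq env_val_abs free_val_const)

end

section \<open>Creation and annihilation operators\<close>

text \<open>
  The Fock space is modelled by functions on finite sets: the value of \<open>f\<close> at \<open>A\<close> is the coefficient
  of the wedge product of the elements of \<open>A\<close> in increasing order. The Jordan--Wigner sign counts the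
  transpositions that bring a new factor \<open>x\<close> from the front to its place; the order is the one
  transported from the naturals.
\<close>

definition jw :: "'x::finite \<Rightarrow> 'x set \<Rightarrow> 'v::ab_group_add \<Rightarrow> 'v" where
  "jw x A v = (if even (card {y \<in> A. to_nat y < to_nat x}) then v else - v)"

lemma jw_add: "jw x A (v + w) = jw x A v + jw x A w"
  by (simp add: jw_def)

lemma jw_uminus [simp]: "jw x A (- v) = - jw x A v"
  by (simp add: jw_def)

lemma jw_jw [simp]: "jw x A (jw x A v) = v"
  by (simp add: jw_def)

lemma jw_0 [simp]: "jw x A 0 = 0"
  by (simp add: jw_def)

lemma jw_commute: "jw x A (jw y B v) = jw y B (jw x A v)"
  by (simp add: jw_def)

lemma jw_insert:
  "y \<notin> A \<Longrightarrow> jw x (insert y A) v = (if to_nat y < to_nat x then - jw x A v else jw x A v)"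
proof -
  assume y: "y \<notin> A"
  have "{z \<in> insert y A. to_nat z < to_nat x} =
      (if to_nat y < to_nat x then insert y {z \<in> A. to_nat z < to_nat x}
       else {z \<in> A. to_nat z < to_nat x})"
    by auto
  then show ?thesis using y by (simp add: jw_def)
qed

lemma jw_remove:
  "y \<in> A \<Longrightarrow> jw x (A - {y}) v = (if to_nat y < to_nat x then - jw x A v else jw x A v)"
  using jw_insert[of y "A - {y}" x v] by (simp add: insert_absorb split: if_splits)

lemma app_jw: "app T (jw x A v) = jw x A (app T v)"
  by (simp add: jw_def)

lift_definition create :: "'x::finite \<Rightarrow> ('x set \<Rightarrow> 'v::ab_group_add) endo" is
  "\<lambda>x f A. if x \<in> A then jw x A (f (A - {x})) else 0"
  by (auto simp: fun_eq_iff jw_add)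

lift_definition annihilate :: "'x::finite \<Rightarrow> ('x set \<Rightarrow> 'v::ab_group_add) endo" is
  "\<lambda>x f A. if x \<in> A then 0 else jw x A (f (insert x A))"
  by (auto simp: fun_eq_iff jw_add)

text \<open>
  The action on the coefficients, that is \<open>1 \<otimes> T\<close>.
\<close>

lift_definition pointwise :: "'v endo \<Rightarrow> ('x set \<Rightarrow> 'v::ab_group_add) endo" is
  "\<lambda>T f A. T (f A)"
  by (auto simp: fun_eq_iff)

lemma app_create: "app (create x) f A = (if x \<in> A then jw x A (f (A - {x})) else 0)"
  by (simp add: create.rep_eq)

lemma app_annihilate: "app (annihilate x) f A = (if x \<in> A then 0 else jw x A (f (insert x A)))"
  by (simp add: annihilate.rep_eq)

lemma app_pointwise: "app (pointwise T) f A = app T (f A)"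
  by (simp add: pointwise.rep_eq)

lemmas fock_simps = app_create app_annihilate app_pointwise

lemma to_nat_linear:
  assumes "x \<noteq> (y :: 'x::finite)"
  obtains "to_nat x < to_nat y" "\<not> to_nat y < to_nat x"
  | "to_nat y < to_nat x" "\<not> to_nat x < to_nat y"
proof -
  have "to_nat x \<noteq> to_nat y" using assms by simp
  then show thesis using that by linarith
qed

text \<open>
  The three canonical anticommutation relations hold because, for \<open>x \<noteq> y\<close>, exactly one of the two
  Jordan--Wigner signs changes when the other element is added or removed.
\<close>

lemma create_create:
  "(create x * create y :: ('x::finite set \<Rightarrow> 'v::ab_group_add) endo) = - (create y * create x)"
proof (rule endo_eqI, rule ext)
  fix f :: "'x set \<Rightarrow> 'v" and A
  show "app (create x * create y) f A = app (- (create y * create x)) f A"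
  proof (cases "x = y")
    case False
    have eq: "A - {x} - {y} = A - {y} - {x}" by auto
    show ?thesis
      by (rule to_nat_linear[OF False]; cases "x \<in> A"; cases "y \<in> A")
        (simp_all add: fock_simps jw_remove jw_commute[of x _ y] eq False False[symmetric])
  qed (simp add: fock_simps)
qed

lemma annihilate_annihilate:
  "(annihilate x * annihilate y :: ('x::finite set \<Rightarrow> 'v::ab_group_add) endo)
     = - (annihilate y * annihilate x)"
proof (rule endo_eqI, rule ext)
  fix f :: "'x set \<Rightarrow> 'v" and A
  show "app (annihilate x * annihilate y) f A = app (- (annihilate y * annihilate x)) f A"
  proof (cases "x = y")
    case False
    have eq: "insert x (insert y A) = insert y (insert x A)" by auto
    show ?thesis
      by (rule to_nat_linear[OF False]; cases "x \<in> A"; cases "y \<in> A")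
        (simp_all add: fock_simps jw_insert jw_commute[of x _ y] eq False False[symmetric])
  qed (simp add: fock_simps)
qed

lemma annihilate_create:
  "(annihilate x * create y :: ('x::finite set \<Rightarrow> 'v::ab_group_add) endo)
     = (if x = y then 1 else 0) - create y * annihilate x"
proof (rule endo_eqI, rule ext)
  fix f :: "'x set \<Rightarrow> 'v" and A
  show "app (annihilate x * create y) f A
      = app ((if x = y then 1 else 0) - create y * annihilate x) f A"
  proof (cases "x = y")
    case True
    then show ?thesis
      by (cases "y \<in> A") (simp_all add: fock_simps jw_insert jw_remove insert_absorb)
  next
    case False
    have eq: "insert x A - {y} = insert x (A - {y})" using False by auto
    show ?thesis
      by (rule to_nat_linear[OF False]; cases "x \<in> A"; cases "y \<in> A")
        (simp_all add: fock_simps jw_insert jw_remove jw_commute[of x _ y] eq False False[symmetric])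
  qed
qed

lemma pointwise_create: "pointwise T * create x = create x * pointwise T"
  by (rule endo_eqI, rule ext) (auto simp: fock_simps app_jw)

lemma pointwise_annihilate: "pointwise T * annihilate x = annihilate x * pointwise T"
  by (rule endo_eqI, rule ext) (auto simp: fock_simps app_jw)

lemma pointwise_arith:
  "pointwise (S + T) = pointwise S + pointwise T" "pointwise (S - T) = pointwise S - pointwise T"
  "pointwise (S * T) = pointwise S * pointwise T" "pointwise 1 = 1" "pointwise 0 = 0"
  by (rule endo_eqI, rule ext, simp add: fock_simps)+

section \<open>A representation of \<open>gl(m|n)\<close> built from one of \<open>gl(n)\<close>\<close>

text \<open>
  Here \<open>c \<alpha> i\<close> stands for wedging with the creator \<open>e(\<alpha>,i)\<close>, \<open>d \<alpha> i\<close> for the dual contraction, and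
  \<open>r i j\<close> for the given action of \<open>gl(n)\<close> on the coefficients.
\<close>

locale fermion_gl =
  fixes c d :: "'m::finite \<Rightarrow> 'n::finite \<Rightarrow> 'r::{ring, monoid_mult}"
    and r :: "'n \<Rightarrow> 'n \<Rightarrow> 'r"
  assumes c_c: "c \<alpha> i * c \<beta> j = - (c \<beta> j * c \<alpha> i)"
    and d_d: "d \<alpha> i * d \<beta> j = - (d \<beta> j * d \<alpha> i)"
    and d_c: "d \<alpha> i * c \<beta> j = (if \<alpha> = \<beta> \<and> i = j then 1 else 0) - c \<beta> j * d \<alpha> i"
    and r_c: "r i j * c \<alpha> k = c \<alpha> k * r i j"
    and r_d: "r i j * d \<alpha> k = d \<alpha> k * r i j"
    and r_r: "r i j * r k l =
      r k l * r i j + (if j = k then r i l else 0) - (if i = l then r k j else 0)"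
begin

text \<open>
  The induced action of \<open>gl(m|n)\<close>. On the exterior algebra \<open>e(i,k)\<close> acts by the derivation that the
  bracket with the creators dictates, \<open>[e(i,k), e(\<gamma>,l)] = - \<delta>\<^sub>i\<^sub>l e(\<gamma>,k)\<close>. The operators with a
  virtual second index all have the shape \<open>e(a,\<beta>) = \<Sum>\<^sub>k e(a,k) d(\<beta>,k)\<close>. For virtual \<open>a\<close> this is the usual derivation;
  for proper \<open>a\<close> it is what results from moving \<open>e(a,\<beta>)\<close> to the right through a product of creators.
\<close>

fun G :: "('m, 'n) symb \<Rightarrow> 'n \<Rightarrow> 'r" where
  "G (Virt \<alpha>) k = c \<alpha> k"
| "G (Prop i) k = r i k - (\<Sum>\<gamma>\<in>UNIV. c \<gamma> k * d \<gamma> i)"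

fun E :: "('m, 'n) symb \<Rightarrow> ('m, 'n) symb \<Rightarrow> 'r" where
  "E a (Prop k) = G a k"
| "E a (Virt \<beta>) = (\<Sum>k\<in>UNIV. G a k * d \<beta> k)"

text \<open>
  The quadratic term \<open>c \<gamma> k d \<gamma> i\<close> moves one factor from \<open>i\<close> to \<open>k\<close>; the two relations below are its
  commutators with the linear operators.
\<close>

lemma hop_c: "c \<gamma> k * d \<gamma> i * c \<beta> l = c \<beta> l * (c \<gamma> k * d \<gamma> i) + (if \<gamma> = \<beta> \<and> i = l then c \<gamma> k else 0)"
proof -
  have "c \<gamma> k * d \<gamma> i * c \<beta> l = c \<gamma> k * (d \<gamma> i * c \<beta> l)" by (simp add: mult.assoc)
  also have "\<dots> = (if \<gamma> = \<beta> \<and> i = l then c \<gamma> k else 0) - c \<gamma> k * c \<beta> l * d \<gamma> i"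
    unfolding d_c by (simp add: algebra_simps)
  also have "c \<gamma> k * c \<beta> l * d \<gamma> i = - (c \<beta> l * (c \<gamma> k * d \<gamma> i))"
    unfolding c_c[of \<gamma> k \<beta> l] by (simp add: mult.assoc)
  finally show ?thesis by simp
qed

lemma hop_d: "c \<gamma> k * d \<gamma> i * d \<beta> l = d \<beta> l * (c \<gamma> k * d \<gamma> i) - (if \<gamma> = \<beta> \<and> k = l then d \<gamma> i else 0)"
proof -
  have "d \<beta> l * (c \<gamma> k * d \<gamma> i) = (d \<beta> l * c \<gamma> k) * d \<gamma> i" by (simp add: mult.assoc)
  also have "\<dots> = (if \<gamma> = \<beta> \<and> k = l then d \<gamma> i else 0) - c \<gamma> k * (d \<beta> l * d \<gamma> i)"
    unfolding d_c by (auto simp add: algebra_simps)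
  also have "d \<beta> l * d \<gamma> i = - (d \<gamma> i * d \<beta> l)"
    by (rule d_d)
  finally show ?thesis by (simp add: mult.assoc)
qed

lemma sum_delta_conj:
  "(\<Sum>\<gamma>\<in>UNIV. if \<gamma> = \<beta> \<and> P then f \<gamma> else 0) = (if P then f \<beta> else (0::'r))" for \<beta> :: "'z::finite"
  by (cases P) auto

lemma G_c: "G (Prop i) k * c \<beta> l = c \<beta> l * G (Prop i) k - (if i = l then c \<beta> k else 0)"
  by (simp add: left_diff_distrib right_diff_distrib sum_distrib_left sum_distrib_right hop_c
      sum.distrib sum_delta_conj r_c)

lemma G_d: "G (Prop i) k * d \<beta> l = d \<beta> l * G (Prop i) k + (if k = l then d \<beta> i else 0)"
  by (simp add: left_diff_distrib right_diff_distrib sum_distrib_left sum_distrib_right hop_d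
      sum_subtractf sum_delta_conj r_d)

lemma G_r: "G (Prop i) k * r j l = r j l * G (Prop i) k
   + (if k = j then r i l else 0) - (if i = l then r j k else 0)"
proof -
  have "c \<gamma> k * d \<gamma> i * r j l = r j l * (c \<gamma> k * d \<gamma> i)" for \<gamma>
  proof -
    have "c \<gamma> k * d \<gamma> i * r j l = (c \<gamma> k * r j l) * d \<gamma> i"
      by (simp only: mult.assoc r_d)
    also have "\<dots> = r j l * (c \<gamma> k * d \<gamma> i)"
      by (simp only: r_c[symmetric] mult.assoc)
    finally show ?thesis .
  qed
  then show ?thesis
    by (simp add: left_diff_distrib right_diff_distrib sum_distrib_left sum_distrib_right r_r[of i k j l])
qed

lemma G_G: "G (Prop i) k * G (Prop j) l = G (Prop j) l * G (Prop i) k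
   + (if k = j then G (Prop i) l else 0) - (if i = l then G (Prop j) k else 0)"
proof -
  have *: "G (Prop i) k * (c \<gamma> l * d \<gamma> j) = c \<gamma> l * d \<gamma> j * G (Prop i) k
     + (if k = j then c \<gamma> l * d \<gamma> i else 0) - (if i = l then c \<gamma> k * d \<gamma> j else 0)" for \<gamma>
  proof -
    have "G (Prop i) k * (c \<gamma> l * d \<gamma> j) = (G (Prop i) k * c \<gamma> l) * d \<gamma> j"
      by (simp only: mult.assoc)
    also have "\<dots> = c \<gamma> l * (G (Prop i) k * d \<gamma> j) - (if i = l then c \<gamma> k * d \<gamma> j else 0)"
      unfolding G_c by (simp only: left_diff_distrib mult.assoc if_distrib[of "\<lambda>x. x * _"] mult_zero_left)
    finally show ?thesis
      unfolding G_d by (simp add: distrib_left mult.assoc del: G.simps)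
  qed
  define N where "N i k = (\<Sum>\<gamma>\<in>UNIV. c \<gamma> k * d \<gamma> i)" for i k
  have G: "G (Prop i) k = r i k - N i k" for i k
    by (simp add: N_def)
  have N: "G (Prop i) k * N j l = N j l * G (Prop i) k
     + (if k = j then N i l else 0) - (if i = l then N j k else 0)"
    unfolding N_def sum_distrib_left sum_distrib_right * sum.distrib sum_subtractf
    by (cases "k = j"; cases "i = l") (simp_all del: G.simps)
  have "G (Prop i) k * G (Prop j) l = G (Prop i) k * r j l - G (Prop i) k * N j l"
    by (simp only: G[of j l] right_diff_distrib)
  also have "\<dots> = (r j l - N j l) * G (Prop i) k
     + (if k = j then r i l - N i l else 0) - (if i = l then r j k - N j k else 0)"
    unfolding N G_r left_diff_distrib by (cases "k = j"; cases "i = l") (simp_all del: G.simps)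
  finally show ?thesis by (simp only: G)
qed

lemma c_G: "c \<beta> l * G (Prop i) k = G (Prop i) k * c \<beta> l + (if i = l then c \<beta> k else 0)"
  unfolding G_c by simp

lemma d_G: "d \<beta> l * G (Prop i) k = G (Prop i) k * d \<beta> l - (if k = l then d \<beta> i else 0)"
  unfolding G_d by simp

lemma c_d: "c \<beta> j * d \<alpha> i = (if \<alpha> = \<beta> \<and> i = j then 1 else 0) - d \<alpha> i * c \<beta> j"
  unfolding d_c by simp

text \<open>
  The sign \<open>gl_sign\<close> of the superbracket as an operation on the ring, which has no scalars of its own.
\<close>

definition twist ::
  "('m, 'n) symb \<Rightarrow> ('m, 'n) symb \<Rightarrow> ('m, 'n) symb \<Rightarrow> ('m, 'n) symb \<Rightarrow> 'r \<Rightarrow> 'r" where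
  "twist a b x y z = (if odd ((parity a + parity b) * (parity x + parity y)) then - z else z)"

definition super_rel ::
  "('m, 'n) symb \<Rightarrow> ('m, 'n) symb \<Rightarrow> ('m, 'n) symb \<Rightarrow> ('m, 'n) symb \<Rightarrow> bool" where
  "super_rel a b x y \<longleftrightarrow> E a b * E x y =
     twist a b x y (E x y * E a b) + (if b = x then E a y else 0)
     - twist a b x y (if a = y then E x b else 0)"

lemma twist_cases: "twist a b x y = (\<lambda>z. z) \<or> twist a b x y = uminus"
  unfolding twist_def fun_eq_iff by presburger

lemma twist_swap: "twist a b x y = twist x y a b"
  by (simp only: twist_def fun_eq_iff mult.commute) simp

lemma super_rel_swap: "super_rel a b x y \<Longrightarrow> super_rel x y a b"
  using twist_cases[of a b x y]
  by (elim disjE) (auto simp add: super_rel_def twist_swap[of x y] simp del: E.simps)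

lemma super_rel_Prop_Prop: "super_rel a (Prop k) x (Prop l)"
proof (cases a; cases x)
  fix \<alpha> \<beta> assume "a = Virt \<alpha>" "x = Virt \<beta>"
  then show ?thesis by (simp add: super_rel_def twist_def c_c[of \<alpha> k \<beta> l])
next
  fix \<alpha> j assume "a = Virt \<alpha>" "x = Prop j"
  then show ?thesis by (simp add: super_rel_def twist_def c_G eq_commute del: G.simps(2))
next
  fix i \<beta> assume "a = Prop i" "x = Virt \<beta>"
  then show ?thesis by (simp add: super_rel_def twist_def G_c del: G.simps(2))
next
  fix i j assume "a = Prop i" "x = Prop j"
  then show ?thesis by (simp add: super_rel_def twist_def G_G[of i k j l] del: G.simps(2))
qed

text \<open>
  By \<open>e(a,\<beta>) = \<Sum>\<^sub>k e(a,k) d(\<beta>,k)\<close> the relation reduces to the relations for \<open>e(a,k)\<close> and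
  \<open>e(x,l)\<close> and to moving \<open>d(\<beta>,k)\<close> past \<open>e(x,l)\<close>. For \<open>x\<close> proper the contraction terms of the
  two steps cancel.
\<close>

lemma super_rel_Virt_Prop: "super_rel a (Virt \<beta>) x (Prop l)"
proof -
  have E: "E a (Virt \<beta>) * E x (Prop l) = (\<Sum>k\<in>UNIV. G a k * (d \<beta> k * G x l))"
    by (simp add: sum_distrib_right mult.assoc)
  show ?thesis
  proof (cases x)
    case (Prop j)
    have "E a (Virt \<beta>) * E x (Prop l) = (\<Sum>k\<in>UNIV. G a k * G x l * d \<beta> k) - G a l * d \<beta> j"
      unfolding E unfolding Prop d_G by (simp add: right_diff_distrib sum_subtractf mult.assoc
          if_distrib[of "\<lambda>z. _ * z"] del: G.simps cong: if_cong)
    also have "\<dots> = G x l * E a (Virt \<beta>) - (if a = Prop l then E x (Virt \<beta>) else 0)"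
    proof (cases a)
      case (Virt \<alpha>)
      have "(\<Sum>k\<in>UNIV. G a k * G x l * d \<beta> k) = G x l * E a (Virt \<beta>) + G a l * d \<beta> j"
        unfolding Prop Virt G.simps(1) c_G
        by (simp add: distrib_right sum.distrib mult.assoc sum_distrib_left
            if_distrib[of "\<lambda>z. z * _"] del: G.simps(2) cong: if_cong)
      then show ?thesis by (simp add: Virt)
    next
      case (Prop i)
      have "(\<Sum>k\<in>UNIV. G a k * G x l * d \<beta> k)
          = G x l * E a (Virt \<beta>) + G a l * d \<beta> j - (if i = l then E x (Virt \<beta>) else 0)"
        unfolding Prop \<open>x = Prop j\<close> G_G[of i _ j l]
        by (cases "i = l") (simp_all add: distrib_right left_diff_distrib sum.distrib sum_subtractf
            mult.assoc sum_distrib_left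
            if_distrib[of "\<lambda>z. z * _"] del: G.simps cong: if_cong)
      then show ?thesis by (simp add: Prop)
    qed
    finally show ?thesis by (simp add: super_rel_def twist_def Prop del: G.simps)
  next
    case (Virt \<gamma>)
    have "E a (Virt \<beta>) * E x (Prop l)
        = (if \<beta> = \<gamma> then G a l else 0) - (\<Sum>k\<in>UNIV. G a k * c \<gamma> l * d \<beta> k)"
      unfolding E unfolding Virt G.simps(1) d_c
      by (cases "\<beta> = \<gamma>") (simp_all add: right_diff_distrib sum_subtractf sum_negf mult.assoc
          if_distrib[of "\<lambda>z. _ * z"] del: G.simps cong: if_cong)
    moreover have "(\<Sum>k\<in>UNIV. G a k * c \<gamma> l * d \<beta> k) = (case a of
        Virt \<alpha> \<Rightarrow> - (c \<gamma> l * E a (Virt \<beta>))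
      | Prop i \<Rightarrow> c \<gamma> l * E a (Virt \<beta>) - (if i = l then E x (Virt \<beta>) else 0))"
    proof (cases a)
      case (Virt \<alpha>)
      show ?thesis
        unfolding Virt G.simps(1) c_c[of \<alpha> _ \<gamma> l]
        by (simp add: sum_distrib_left sum_negf mult.assoc)
    next
      case (Prop i)
      show ?thesis
        unfolding Prop G_c
        by (cases "i = l") (simp_all add: \<open>x = Virt \<gamma>\<close> left_diff_distrib sum_subtractf sum_distrib_left mult.assoc
            del: G.simps(2))
    qed
    ultimately show ?thesis
      by (cases a) (auto simp add: super_rel_def twist_def Virt simp del: G.simps(2))
  qed
qed

lemma E_d: "E a (Virt \<beta>) * d \<delta> l = (case a of
     Virt \<alpha> \<Rightarrow> d \<delta> l * E a (Virt \<beta>) - (if \<alpha> = \<delta> then d \<beta> l else 0)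
   | Prop i \<Rightarrow> - (d \<delta> l * E a (Virt \<beta>)) - d \<delta> i * d \<beta> l)"
proof -
  have "G a k * d \<beta> k * d \<delta> l = - (G a k * d \<delta> l * d \<beta> k)" for k
    using d_d[of \<beta> k \<delta> l] by (simp add: mult.assoc)
  then have E: "E a (Virt \<beta>) * d \<delta> l = - (\<Sum>k\<in>UNIV. G a k * d \<delta> l * d \<beta> k)"
    by (simp add: sum_distrib_right sum_negf)
  show ?thesis
  proof (cases a)
    case (Virt \<alpha>)
    show ?thesis
      unfolding E unfolding Virt G.simps(1) c_d
      by (cases "\<alpha> = \<delta>") (simp_all add: left_diff_distrib sum_subtractf sum_distrib_left mult.assoc sum_negf
          if_distrib[of "\<lambda>z. z * _"] cong: if_cong)
  next
    case (Prop i)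
    show ?thesis
      unfolding E unfolding Prop G_d
      by (simp add: distrib_right sum.distrib sum_distrib_left mult.assoc
          if_distrib[of "\<lambda>z. z * _"] del: G.simps cong: if_cong)
  qed
qed

text \<open>
  Now also the right factor is expanded. For proper \<open>a\<close> the correction terms
  \<open>e(x,l) d(\<delta>,i) d(\<beta>,l)\<close> cancel because the contractions anticommute.
\<close>

lemma super_rel_Virt_Virt: "super_rel a (Virt \<beta>) x (Virt \<delta>)"
proof -
  (* The sign for moving e(a,\<beta>) past e(x,l); it is the same for all proper l. *)
  define s where "s z = twist a (Virt \<beta>) x (Prop undefined) z" for z
  have s: "s (y + z) = s y + s z" "s (y - z) = s y - s z" "s y * z = s (y * z)" "s (- y) = - s y"
    "s 0 = 0" "s (sum f I) = (\<Sum>i\<in>I. s (f i))" for y z :: 'r and f :: "'n \<Rightarrow> 'r" and I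
    using twist_cases[of a "Virt \<beta>" x "Prop undefined"] by (auto simp: s_def sum_negf)
  have "E a (Virt \<beta>) * E x (Virt \<delta>) = (\<Sum>l\<in>UNIV. E a (Virt \<beta>) * E x (Prop l) * d \<delta> l)"
    by (simp add: sum_distrib_left mult.assoc)
  also have "\<dots> = (\<Sum>l\<in>UNIV. s (G x l * (E a (Virt \<beta>) * d \<delta> l))
      + (if Virt \<beta> = x then G a l * d \<delta> l else 0)
      - (if a = Prop l then s (E x (Virt \<beta>) * d \<delta> l) else 0))" (is "_ = sum ?f _")
  proof (rule sum.cong[OF refl])
    fix l
    have "E a (Virt \<beta>) * E x (Prop l) = s (G x l * E a (Virt \<beta>)) + (if Virt \<beta> = x then G a l else 0)
       - s (if a = Prop l then E x (Virt \<beta>) else 0)"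
      using super_rel_Virt_Prop[of a \<beta> x l] by (simp add: super_rel_def s_def twist_def del: E.simps(2))
    then show "E a (Virt \<beta>) * E x (Prop l) * d \<delta> l = ?f l"
      by (simp add: distrib_right left_diff_distrib s mult.assoc del: E.simps G.simps)
  qed
  also have "\<dots> = (case a of
      Virt \<alpha> \<Rightarrow> s (E x (Virt \<delta>) * E a (Virt \<beta>)) - (if \<alpha> = \<delta> then s (E x (Virt \<beta>)) else 0)
    | Prop i \<Rightarrow> - s (E x (Virt \<delta>) * E a (Virt \<beta>))) + (if Virt \<beta> = x then E a (Virt \<delta>) else 0)"
  proof (cases a)
    case (Virt \<alpha>)
    have "(\<Sum>l\<in>UNIV. s (G x l * (E a (Virt \<beta>) * d \<delta> l))) =
       s (E x (Virt \<delta>) * E a (Virt \<beta>)) - (if \<alpha> = \<delta> then s (E x (Virt \<beta>)) else 0)"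
      unfolding E_d by (cases "\<alpha> = \<delta>") 
        (simp_all add: Virt right_diff_distrib sum_subtractf s sum_distrib_right mult.assoc del: G.simps)
    then show ?thesis
      by (simp add: Virt sum.distrib del: G.simps)
  next
    case (Prop i)
    have "G x l * (E a (Virt \<beta>) * d \<delta> l)
        = - (G x l * d \<delta> l * E a (Virt \<beta>)) + G x l * d \<beta> l * d \<delta> i" for l
      unfolding E_d Prop using d_d[of \<delta> i \<beta> l]
      by (simp add: right_diff_distrib mult.assoc del: E.simps G.simps)
    then have "(\<Sum>l\<in>UNIV. s (G x l * (E a (Virt \<beta>) * d \<delta> l))) =
       - s (E x (Virt \<delta>) * E a (Virt \<beta>)) + s (E x (Virt \<beta>) * d \<delta> i)"
      by (simp add: sum.distrib sum_subtractf s sum_distrib_right sum_negf del: G.simps)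
    moreover have "(\<Sum>l\<in>UNIV. if a = Prop l then s (E x (Virt \<beta>) * d \<delta> l) else 0) = s (E x (Virt \<beta>) * d \<delta> i)"
      by (simp add: Prop del: E.simps)
    ultimately show ?thesis
      by (simp add: Prop sum.distrib sum_subtractf del: G.simps)
  qed
  finally show ?thesis
    by (cases a; cases x) (auto simp add: super_rel_def twist_def s_def simp del: E.simps)
qed

lemma super_rel: "super_rel a b x y"
  by (cases b; cases y)
    (auto intro: super_rel_Prop_Prop super_rel_Virt_Prop super_rel_Virt_Virt
      super_rel_swap[OF super_rel_Virt_Prop])

end

section \<open>The Fock module and its vacuum\<close>

text \<open>
  The operators \<open>r i j\<close> are kept abstract because two modules are needed: an arbitrary
  \<open>gl(n)\<close>-module, and \<open>U(gl(m|n))\<close> itself.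
\<close>

locale fock = vector_space scl
  for scl :: "complex \<Rightarrow> 'v::ab_group_add \<Rightarrow> 'v" +
  fixes r :: "'n::finite \<Rightarrow> 'n \<Rightarrow> 'v endo"
    and virtual_type :: "'m::finite itself"
  assumes r_scl: "app (r i j) (scl z v) = scl z (app (r i j) v)"
    and r_r: "r i j * r k l = r k l * r i j + (if j = k then r i l else 0) - (if i = l then r k j else 0)"
begin

sublocale fermion_gl
  "\<lambda>(\<alpha> :: 'm) i. create (\<alpha>, i)" "\<lambda>\<alpha> i. annihilate (\<alpha>, i)" "\<lambda>i j. pointwise (r i j)"
proof
  fix i j k l
  show "pointwise (r i j) * pointwise (r k l) = pointwise (r k l) * pointwise (r i j)
     + (if j = k then pointwise (r i l) else 0) - (if i = l then pointwise (r k j) else 0)"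
    using arg_cong[OF r_r[of i j k l], of pointwise]
    by (auto simp: pointwise_arith split: if_splits)
qed (auto simp: annihilate_create pointwise_create pointwise_annihilate
      intro: create_create annihilate_annihilate)

definition scal :: "complex \<Rightarrow> (('m \<times> 'n) set \<Rightarrow> 'v) endo" where
  "scal z = pointwise (Endo (scl z))"

lemma app_Endo_scl: "app (Endo (scl z)) v = scl z v"
  by (simp add: Endo_inverse scale_right_distrib)

lemma app_scal: "app (scal z) f A = scl z (f A)"
  by (simp add: scal_def app_pointwise app_Endo_scl)

lemma scal_pointwise_r: "scal z * pointwise (r i j) = pointwise (r i j) * scal z"
  by (rule endo_eqI, rule ext) (simp add: app_scal app_pointwise r_scl)

lemma scal_G: "scal z * G a k = G a k * scal z"
proof (cases a)
  case (Virt \<alpha>)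
  then show ?thesis by (simp add: scal_def pointwise_create)
next
  case (Prop i)
  have "scal z * (create x * annihilate y) = create x * annihilate y * scal z" for x y :: "'m \<times> 'n"
    by (simp add: scal_def pointwise_create pointwise_annihilate mult.assoc[symmetric])
      (simp add: scal_def pointwise_create pointwise_annihilate mult.assoc)
  then show ?thesis
    by (simp add: Prop right_diff_distrib left_diff_distrib sum_distrib_left sum_distrib_right
        scal_pointwise_r)
qed

lemma scal_E: "scal z * E a b = E a b * scal z"
proof (cases b)
  case (Virt \<beta>)
  have "scal z * (G a k * annihilate (\<beta>, k)) = G a k * annihilate (\<beta>, k) * scal z" for k
  proof -
    have "scal z * (G a k * annihilate (\<beta>, k)) = G a k * (scal z * annihilate (\<beta>, k))"
      by (simp add: mult.assoc[symmetric] scal_G)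
    then show ?thesis by (simp add: mult.assoc scal_def pointwise_annihilate)
  qed
  then show ?thesis by (simp add: Virt sum_distrib_left sum_distrib_right del: G.simps)
qed (simp add: scal_G del: G.simps)

lemma scal_gl_sign: "scal (gl_sign a b c d) * x = twist a b c d x"
proof -
  have "scal 1 = 1" "scal (- 1) = - 1"
    by (rule endo_eqI, rule ext, simp add: app_scal)+
  then show ?thesis
    by (simp add: gl_sign_def twist_def minus_one_power_iff del: even_mult_iff even_add)
qed

sublocale env_representation scal E
proof
  fix y z a b c d
  show "scal (y + z) = scal y + scal z" "scal (y * z) = scal y * scal z" "scal 1 = 1"
    by (rule endo_eqI, rule ext, simp add: app_scal scale_left_distrib)+
  show "scal z * E a b = E a b * scal z"
    by (rule scal_E)
  show "E a b * E c d = scal (gl_sign a b c d) * E c d * E a b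
      + (if b = c then E a d else 0) - scal (gl_sign a b c d) * (if a = d then E c b else 0)"
    using super_rel[of a b c d]
    unfolding super_rel_def unfolding mult.assoc unfolding scal_gl_sign by simp
qed

definition vac :: "'v \<Rightarrow> ('m \<times> 'n) set \<Rightarrow> 'v" where
  "vac v A = (if A = {} then v else 0)"

lemma vac_inject: "vac v = vac w \<longleftrightarrow> v = w"
  by (metis vac_def)

lemma vac_add: "vac (v + w) = vac v + vac w"
  by (auto simp: vac_def)

lemma vac_0: "vac 0 = 0"
  by (auto simp: vac_def)

lemma scal_vac: "app (scal z) (vac v) = vac (scl z v)"
  by (auto simp: vac_def app_scal)

lemma annihilate_vac: "app (annihilate x) (vac v) = 0"
  by (auto simp: vac_def app_annihilate)

lemma E_Virt_vac: "app (E a (Virt \<beta>)) (vac v) = 0"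
  by (simp add: app_sum annihilate_vac del: G.simps)

lemma E_Prop_vac: "app (E (Prop i) (Prop j)) (vac v) = vac (app (r i j) v)"
proof -
  have "app (pointwise (r i j)) (vac v) = vac (app (r i j) v)"
    by (auto simp: vac_def app_pointwise)
  then show ?thesis by (simp add: app_sum annihilate_vac)
qed

lemma sum_fun_apply: "(\<Sum>i\<in>I. g i) x = (\<Sum>i\<in>I. g i x)"
  for g :: "'i \<Rightarrow> 'a \<Rightarrow> 'b::comm_monoid_add"
  by (induction I rule: infinite_finite_induct) auto

text \<open>
  \<open>e(\<gamma>,\<gamma>)\<close> counts the creators with virtual symbol \<open>\<gamma>\<close>.
\<close>

lemma number_operator:
  "app (E (Virt \<gamma>) (Virt \<gamma>)) f A = scl (of_nat (card {k. (\<gamma>, k) \<in> A})) (f A)"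
proof -
  have "app (create x) (app (annihilate x) f) A = (if x \<in> A then f A else 0)" for x
    by (simp add: fock_simps jw_remove insert_absorb)
  then have "app (E (Virt \<gamma>) (Virt \<gamma>)) f A = (\<Sum>k\<in>UNIV. if (\<gamma>, k) \<in> A then f A else 0)"
    by (simp add: app_sum sum_fun_apply)
  also have "\<dots> = scl (\<Sum>k\<in>UNIV. if (\<gamma>, k) \<in> A then 1 else 0) (f A)"
    by (simp add: scale_sum_left if_distrib[of "\<lambda>z. scl z _"] cong: if_cong)
  also have "(\<Sum>k\<in>UNIV. if (\<gamma>, k) \<in> A then 1 else 0) = (of_nat (card {k. (\<gamma>, k) \<in> A}) :: complex)"
    by (simp add: sum.If_cases)
  finally show ?thesis .
qed

text \<open>
  A number of creators is never negative.
\<close>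

lemma negative_weight_zero:
  assumes "app (E (Virt \<gamma>) (Virt \<gamma>)) f = app (scal (of_int z)) f" "z < 0"
  shows "f = 0"
proof
  fix A :: "('m \<times> 'n) set"
  let ?k = "card {k. (\<gamma>, k) \<in> A}"
  have "scl (of_nat ?k) (f A) = scl (of_int z) (f A)"
    using fun_cong[OF assms(1), of A] by (simp only: number_operator app_scal)
  then have "scl (of_int (int ?k - z)) (f A) = 0"
    by (simp add: scale_left_diff_distrib)
  then show "f A = 0 A" using assms(2) by (auto simp del: of_int_diff)
qed

lemma app_scal_E: "app (E a b) (app (scal z) f) = app (scal z) (app (E a b) f)"
  using arg_cong[OF scal_E[of z a b], of "\<lambda>T. app T f"] by (simp del: E.simps)

definition weight :: "'m \<Rightarrow> (('m, 'n) symb \<times> ('m, 'n) symb) list \<Rightarrow> int" where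
  "weight \<gamma> u = int (count_list (map fst u) (Virt \<gamma>)) - int (count_list (map snd u) (Virt \<gamma>))"

lemma word_val_Cons: "word_val ((a, b) # u) = E a b * word_val u"
  by (simp add: word_val_def del: E.simps)

lemma word_val_append: "word_val (u @ w) = word_val u * word_val w"
  by (simp add: word_val_def del: E.simps)

lemma word_weight:
  "app (E (Virt \<gamma>) (Virt \<gamma>)) (app (word_val u) (vac v))
     = app (scal (of_int (weight \<gamma> u))) (app (word_val u) (vac v))"
proof (induction u)
  case Nil
  then show ?case
    by (simp add: word_val_def weight_def E_Virt_vac scal_0 del: E.simps)
next
  case (Cons p u)
  obtain a b where p: "p = (a, b)" by force
  let ?f = "app (word_val u) (vac v)"
  have "E (Virt \<gamma>) (Virt \<gamma>) * E a b = E a b * E (Virt \<gamma>) (Virt \<gamma>)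
      + (if Virt \<gamma> = a then E a b else 0) - (if b = Virt \<gamma> then E a b else 0)"
    using E_commute[of "Virt \<gamma>" "Virt \<gamma>" a b] by (auto simp: gl_sign_def scal_1 simp del: E.simps)
  from arg_cong[OF this, of "\<lambda>T. app T ?f"]
  have "app (E (Virt \<gamma>) (Virt \<gamma>)) (app (E a b) ?f)
     = app (E a b) (app (E (Virt \<gamma>) (Virt \<gamma>)) ?f)
      + (if Virt \<gamma> = a then app (E a b) ?f else 0) - (if b = Virt \<gamma> then app (E a b) ?f else 0)"
    by (cases "Virt \<gamma> = a"; cases "b = Virt \<gamma>") (simp_all del: E.simps)
  also have "app (E a b) (app (E (Virt \<gamma>) (Virt \<gamma>)) ?f) = app (scal (of_int (weight \<gamma> u))) (app (E a b) ?f)"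
    unfolding Cons by (rule app_scal_E)
  also have "\<dots> + (if Virt \<gamma> = a then app (E a b) ?f else 0) - (if b = Virt \<gamma> then app (E a b) ?f else 0)
     = app (scal (of_int (weight \<gamma> (p # u)))) (app (E a b) ?f)"
  proof (rule ext)
    fix A
    have w: "weight \<gamma> (p # u)
        = weight \<gamma> u + (if Virt \<gamma> = a then 1 else 0) - (if b = Virt \<gamma> then 1 else 0)"
      by (simp add: weight_def p)
    show "(app (scal (of_int (weight \<gamma> u))) (app (E a b) ?f) + (if Virt \<gamma> = a then app (E a b) ?f else 0)
          - (if b = Virt \<gamma> then app (E a b) ?f else 0)) A
        = app (scal (of_int (weight \<gamma> (p # u)))) (app (E a b) ?f) A"
      unfolding w
      by (cases "Virt \<gamma> = a"; cases "b = Virt \<gamma>")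
        (simp_all add: app_scal scale_left_distrib scale_left_diff_distrib del: E.simps)
  qed
  finally show ?case by (simp add: p word_val_Cons del: E.simps)
qed

text \<open>
  Before this factor acts, \<open>\<gamma>\<close> has been created at most as often as it has been annihilated, so the
  number of its creators is \<open>\<le> 0\<close>. If it is negative the vector vanishes already. If it is \<open>0\<close>, then the factor is
  \<open>e(a,\<gamma>)\<close>: it makes the number negative for \<open>a \<noteq> \<gamma>\<close>, and is the number operator for
  \<open>a = \<gamma>\<close>.
\<close>

lemma irregular_step_vac:
  assumes "count_list (map snd ((a, b) # u)) (Virt \<gamma>) > count_list (map fst u) (Virt \<gamma>)"
  shows "app (word_val ((a, b) # u)) (vac v) = 0"
proof (cases "weight \<gamma> u < 0")
  case True
  then have "app (word_val u) (vac v) = 0"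
    using negative_weight_zero word_weight by blast
  then show ?thesis by (simp add: word_val_Cons del: E.simps)
next
  case False
  with assms have b: "b = Virt \<gamma>" and w: "weight \<gamma> u = 0"
    by (auto simp: weight_def split: if_splits)
  show ?thesis
  proof (cases "a = Virt \<gamma>")
    case True
    have "app (E a b) (app (word_val u) (vac v)) = 0"
      using word_weight[of \<gamma> u v] unfolding w True b by (simp add: scal_0 del: E.simps)
    then show ?thesis by (simp add: word_val_Cons del: E.simps)
  next
    case False
    have "weight \<gamma> ((a, b) # u) = - 1"
      using w b False by (simp add: weight_def)
    then have "weight \<gamma> ((a, b) # u) < 0" by simp
    then show ?thesis using negative_weight_zero word_weight by blast
  qed
qed

lemma env_val_gl_prod: "env_val (gl_prod w) = word_val w"
proof (induction w)
  case Nil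
  have "env_val (env_const 1) = 1" by (simp only: env_val_const scal_1)
  then show ?case by (simp add: gl_prod_def word_val_def)
qed (auto simp: gl_prod_def env_val_mult env_val_gen word_val_Cons simp del: E.simps)

lemma irregular_vac:
  assumes "irregular w"
  shows "app (word_val w) (vac v) = 0"
proof -
  obtain i \<gamma> where i: "i < length w"
    and *: "count_list (map snd (take (Suc i) (rev w))) (Virt \<gamma>)
        > count_list (map fst (take i (rev w))) (Virt \<gamma>)"
    using assms by (auto simp: irregular_def)
  (* Factors are counted from the right, so the first i of them form the suffix u. *)
  define u where "u = drop (length w - i) w"
  obtain a b where ab: "w ! (length w - Suc i) = (a, b)" by force
  have ab_u: "drop (length w - Suc i) w = (a, b) # u"
    using i ab by (simp add: u_def Cons_nth_drop_Suc[symmetric] Suc_diff_Suc)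
  have "take (Suc i) (rev w) = rev ((a, b) # u)" "take i (rev w) = rev u"
    using ab_u by (simp_all add: take_rev u_def)
  then have "count_list (map snd ((a, b) # u)) (Virt \<gamma>) > count_list (map fst u) (Virt \<gamma>)"
    using * by (simp add: rev_map[symmetric] del: rev.simps)
  then have "app (word_val ((a, b) # u)) (vac v) = 0"
    by (rule irregular_step_vac)
  moreover have "w = take (length w - Suc i) w @ (a, b) # u"
    by (simp flip: ab_u)
  then have "word_val w = word_val (take (length w - Suc i) w) * word_val ((a, b) # u)"
    by (simp flip: word_val_append)
  ultimately show ?thesis by simp
qed

lemma Irr_vac:
  assumes "x \<in> Irr"
  shows "app (env_val x) (vac v) = 0"
  using assms unfolding Irr_def
proof induction
  case zero
  have "env_val (env_const 0) = 0" by (simp only: env_val_const scal_0)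
  then show ?case by simp
qed (auto simp: env_val_mult env_val_add env_val_gl_prod irregular_vac)

end

section \<open>Uniqueness of devirtualization and of the action\<close>

lemma proper_env_uminus: "x \<in> proper_env \<Longrightarrow> - x \<in> proper_env"
  using proper_env.mult[OF proper_env.const[of "- 1"], of x] by (simp add: env_const_uminus)

lemma left_ideal_gen_mult: "x \<in> left_ideal_gen S \<Longrightarrow> a * x \<in> left_ideal_gen S"
  by (induction rule: left_ideal_gen.induct)
    (auto simp: distrib_left mult.assoc[symmetric] intro: left_ideal_gen.intros)

lemma left_ideal_gen_uminus: "x \<in> left_ideal_gen S \<Longrightarrow> - x \<in> left_ideal_gen S"
  using left_ideal_gen_mult[of x S "- 1"] by simp

lemma left_ideal_gen_diff:
  "x \<in> left_ideal_gen S \<Longrightarrow> y \<in> left_ideal_gen S \<Longrightarrow> x - y \<in> left_ideal_gen S"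
  using left_ideal_gen.add[OF _ left_ideal_gen_uminus] by force

lemma app_Endo: "(\<And>x y. T (x + y) = T x + T y) \<Longrightarrow> app (Endo T) x = T x"
  by (simp add: Endo_inverse)

text \<open>
  \<open>U(gl(m|n))\<close> is a \<open>gl(n)\<close>-module under left multiplication.
\<close>

lemma fock_env_gl:
  "fock (\<lambda>z x :: ('m::finite, 'n::finite) env_gl. env_const z * x)
     (\<lambda>i j. Endo (\<lambda>x. gl_gen (Prop i) (Prop j) * x))"
proof unfold_locales
  fix i j k l :: 'n and z w and x y :: "('m, 'n) env_gl"
  have app: "app (Endo (\<lambda>x. gl_gen (Prop i) (Prop j) * x)) x = gl_gen (Prop i) (Prop j) * x"
    for i j :: 'n and x :: "('m, 'n) env_gl"
    by (simp add: app_Endo distrib_left)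
  show "env_const z * (x + y) = env_const z * x + env_const z * y"
    by (simp add: distrib_left)
  show "env_const (z + w) * x = env_const z * x + env_const w * x"
    by (simp add: env_const_add distrib_right)
  show "env_const z * (env_const w * x) = env_const (z * w) * x"
    by (simp add: env_const_mult mult.assoc)
  show "env_const 1 * x = x" by simp
  show "app (Endo (\<lambda>x. gl_gen (Prop i) (Prop j) * x)) (env_const z * x)
      = env_const z * app (Endo (\<lambda>x. gl_gen (Prop i) (Prop j) * x)) x"
    by (simp add: app env_const_central[of z "gl_gen _ _"] flip: mult.assoc)
  let ?r = "\<lambda>i j. Endo (\<lambda>x :: ('m, 'n) env_gl. gl_gen (Prop i) (Prop j) * x)"
  show "?r i j * ?r k l = ?r k l * ?r i j + (if j = k then ?r i l else 0) - (if i = l then ?r k j else 0)"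
  proof (rule endo_eqI)
    fix x :: "('m, 'n) env_gl"
    have "gl_gen (Prop i) (Prop j) * gl_gen (Prop k) (Prop l) = gl_gen (Prop k) (Prop l) * gl_gen (Prop i) (Prop j)
        + (if j = k then gl_gen (Prop i) (Prop l) else 0)
        - (if i = l then gl_gen (Prop k) (Prop j) else 0 :: ('m, 'n) env_gl)"
      using gl_gen_commute[of "Prop i" "Prop j" "Prop k" "Prop l"] by (simp add: gl_sign_def)
    from arg_cong[OF this, of "\<lambda>y. y * x"]
    show "app (?r i j * ?r k l) x
        = app (?r k l * ?r i j + (if j = k then ?r i l else 0) - (if i = l then ?r k j else 0)) x"
      by (cases "j = k"; cases "i = l") (simp_all add: app distrib_right left_diff_distrib mult.assoc)
  qed
qed

text \<open>
  Acting on the vacuum vector of \<open>1\<close> in the Fock module over \<open>U(gl(m|n))\<close>, the element \<open>u\<close> returns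
  the vacuum vector of \<open>u\<close> because it is proper, and \<open>0\<close> because it lies in \<open>Irr\<close>.
\<close>

lemma proper_env_Irr:
  fixes u :: "('m::finite, 'n::finite) env_gl"
  assumes "u \<in> proper_env" "u \<in> Irr"
  shows "u = 0"
proof -
  interpret fock "\<lambda>z x :: ('m, 'n) env_gl. env_const z * x"
    "\<lambda>i j. Endo (\<lambda>x. gl_gen (Prop i) (Prop j) * x)" "TYPE('m)"
    by (rule fock_env_gl)
  have "app (env_val u) (vac x) = vac (u * x)" for x
    using assms(1)
    by (induction arbitrary: x)
      (simp_all add: env_val_const scal_vac env_val_gen E_Prop_vac app_Endo distrib_left
        env_val_add env_val_mult distrib_right vac_add mult.assoc del: E.simps)
  moreover have "app (env_val u) (vac 1) = 0"
    using assms(2) by (rule Irr_vac)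
  ultimately have "vac (u * 1) = vac 0"
    by (simp add: vac_0)
  then show ?thesis by (simp add: vac_inject)
qed

lemma devirt_eqI:
  fixes x u :: "('m::finite, 'n::finite) env_gl"
  assumes "u \<in> proper_env" "x - u \<in> Irr"
  shows "devirt x = u"
  unfolding devirt_def
proof (rule the_equality)
  fix w assume w: "w \<in> proper_env \<and> x - w \<in> Irr"
  have "w - u \<in> proper_env"
    using w assms(1) proper_env.add[of w, OF _ proper_env_uminus[of u]] by simp
  moreover have "w - u \<in> Irr"
    using left_ideal_gen_diff[of "x - u" _ "x - w"] w assms(2) by (simp add: Irr_def)
  ultimately show "w = u" using proper_env_Irr[of "w - u"] by simp
qed (use assms in auto)

context gl_module
begin

lemma action_linear: "\<rho> A (x + y) = \<rho> A x + \<rho> A y" "\<rho> A (scl z x) = scl z (\<rho> A x)"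
proof -
  interpret Vector_Spaces.linear scl scl "\<rho> A"
    by (rule linear_action)
  show "\<rho> A (x + y) = \<rho> A x + \<rho> A y" "\<rho> A (scl z x) = scl z (\<rho> A x)"
    by (rule add, rule scale)
qed

lemma action_0: "\<rho> 0 x = 0"
  using action_add[of 0 0 x] by simp

lemma action_diff: "\<rho> (A - B) x = \<rho> A x - \<rho> B x"
  using action_add[of "A - B" B x] by (simp add: eq_diff_eq)

lemma elem_matrix_mult:
  "elem_matrix i j ** elem_matrix k l = (if j = k then elem_matrix i l else (0 :: complex^'n^'n))"
  by (auto simp: vec_eq_iff elem_matrix_def matrix_matrix_mult_def if_distrib[of "\<lambda>x. x * _"]
      cong: if_cong conj_cong)

lemma fock_gl_module: "fock scl (\<lambda>i j. Endo (\<rho> (elem_matrix i j)))"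
proof unfold_locales
  fix i j k l :: 'n and z v
  have app: "app (Endo (\<rho> (elem_matrix i j))) v = \<rho> (elem_matrix i j) v" for i j v
    by (simp add: app_Endo action_linear)
  show "app (Endo (\<rho> (elem_matrix i j))) (scl z v) = scl z (app (Endo (\<rho> (elem_matrix i j))) v)"
    by (simp add: app action_linear)
  let ?r = "\<lambda>i j. Endo (\<rho> (elem_matrix i j))"
  show "?r i j * ?r k l = ?r k l * ?r i j + (if j = k then ?r i l else 0) - (if i = l then ?r k j else 0)"
  proof (rule endo_eqI)
    fix v
    have "\<rho> (elem_matrix i j) (\<rho> (elem_matrix k l) v) - \<rho> (elem_matrix k l) (\<rho> (elem_matrix i j) v)
        = (if j = k then \<rho> (elem_matrix i l) v else 0) - (if l = i then \<rho> (elem_matrix k j) v else 0)"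
      unfolding action_bracket[symmetric] elem_matrix_mult by (auto simp: action_diff action_0)
    then have "\<rho> (elem_matrix i j) (\<rho> (elem_matrix k l) v) = \<rho> (elem_matrix k l) (\<rho> (elem_matrix i j) v)
        + ((if j = k then \<rho> (elem_matrix i l) v else 0) - (if l = i then \<rho> (elem_matrix k j) v else 0))"
      by (simp only: diff_eq_eq add.commute)
    then show "app (?r i j * ?r k l) v
        = app (?r k l * ?r i j + (if j = k then ?r i l else 0) - (if i = l then ?r k j else 0)) v"
      by (cases "j = k"; cases "i = l") (simp_all add: app)
  qed
qed

end

context fock
begin

lemma env_acts_by_vac:
  assumes "\<And>i j v. app (r i j) v = \<rho> (elem_matrix i j) v" and "env_acts_by scl \<rho> u T"
  shows "app (env_val u) (vac v) = vac (T v)"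
  using assms(2)
  by (induction arbitrary: v)
    (simp_all add: env_val_const scal_vac env_val_gen E_Prop_vac assms(1)
      env_val_add env_val_mult vac_add del: E.simps)

text \<open>
  The Fock module determines the operator of a proper element uniquely, since vacuum vectors
  determine their coefficients.
\<close>

lemma env_action_vac:
  assumes "\<And>i j v. app (r i j) v = \<rho> (elem_matrix i j) v" and "u \<in> proper_env"
  shows "app (env_val u) (vac v) = vac (env_action scl \<rho> u v)"
proof -
  have "\<exists>T. env_acts_by scl \<rho> u T"
    using assms(2) by induction (blast intro: env_acts_by.intros)+
  then obtain T where T: "env_acts_by scl \<rho> u T" ..
  moreover have "T' = T" if "env_acts_by scl \<rho> u T'" for T'
  proof
    fix v
    have "vac (T' v) = vac (T v)"
      using env_acts_by_vac[of \<rho> u _ v, OF assms(1)] T that by metis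
    then show "T' v = T v" by (simp add: vac_inject)
  qed
  ultimately have "env_action scl \<rho> u = T"
    unfolding env_action_def by blast
  then show ?thesis using env_acts_by_vac[OF assms(1) T] by simp
qed

end

section \<open>Normal ordering\<close>

text \<open>
  The one-letter words \<open>e(a,\<beta>)\<close> are irregular. Normal ordering leaves its remainders in the
  left ideal that they generate, which therefore lies in \<open>Irr\<close>.
\<close>

definition ann_ideal :: "('m, 'n) env_gl set" where
  "ann_ideal = left_ideal_gen {gl_gen a (Virt \<beta>) | a \<beta>. True}"

lemma ann_ideal_gen: "x * gl_gen a (Virt \<beta>) \<in> ann_ideal"
  unfolding ann_ideal_def by (rule left_ideal_gen.gen) auto

lemmas ann_ideal_mult = left_ideal_gen_mult[of _ "{gl_gen a (Virt \<beta>) | a \<beta>. True}", folded ann_ideal_def]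
lemmas ann_ideal_add = left_ideal_gen.add[of _ "{gl_gen a (Virt \<beta>) | a \<beta>. True}", folded ann_ideal_def]
lemmas ann_ideal_diff = left_ideal_gen_diff[of _ "{gl_gen a (Virt \<beta>) | a \<beta>. True}", folded ann_ideal_def]
lemmas ann_ideal_uminus = left_ideal_gen_uminus[of _ "{gl_gen a (Virt \<beta>) | a \<beta>. True}", folded ann_ideal_def]
lemmas ann_ideal_zero = left_ideal_gen.zero[of "{gl_gen a (Virt \<beta>) | a \<beta>. True}", folded ann_ideal_def]

lemma ann_ideal_subset_Irr: "ann_ideal \<subseteq> Irr"
proof
  fix x :: "('m, 'n) env_gl" assume "x \<in> ann_ideal"
  then show "x \<in> Irr"
    unfolding ann_ideal_def
  proof induction
    case (gen s a)
    then obtain b \<beta> where s: "s = gl_gen b (Virt \<beta>)" by auto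
    have "irregular [(b, Virt \<beta>)]" unfolding irregular_def by auto
    moreover have "s = gl_prod [(b, Virt \<beta>)]" by (simp add: s gl_prod_def)
    ultimately show ?case unfolding Irr_def by (blast intro: left_ideal_gen.gen)
  qed (auto simp: Irr_def intro: left_ideal_gen.intros)
qed

text \<open>
  \<open>e(a,\<beta>)\<close> passes a proper generator at the cost of another \<open>e(i,\<beta>)\<close>.
\<close>

lemma ann_ideal_proper_env:
  assumes "u \<in> proper_env" "x \<in> ann_ideal"
  shows "x * u \<in> ann_ideal"
  using assms
proof (induction arbitrary: x)
  case (const z)
  then show ?case by (simp flip: env_const_central add: ann_ideal_mult)
next
  case (gen i j)
  then show ?case
    unfolding ann_ideal_def
  proof (induction rule: left_ideal_gen.induct)
    case (gen s y)
    then obtain a \<beta> where s: "s = gl_gen a (Virt \<beta>)" by auto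
    have c: "s * gl_gen (Prop i) (Prop j)
        = gl_gen (Prop i) (Prop j) * s - (if a = Prop j then gl_gen (Prop i) (Virt \<beta>) else 0)"
      unfolding s using gl_gen_commute[of a "Virt \<beta>" "Prop i" "Prop j"] by (simp add: gl_sign_def)
    have "y * s * gl_gen (Prop i) (Prop j)
        = y * gl_gen (Prop i) (Prop j) * s - (if a = Prop j then y * gl_gen (Prop i) (Virt \<beta>) else 0)"
      unfolding mult.assoc c by (simp add: right_diff_distrib)
    also have "\<dots> \<in> ann_ideal"
      by (auto simp: s ann_ideal_gen intro: ann_ideal_diff)
    finally show ?case by (simp add: ann_ideal_def)
  qed (auto simp: distrib_right intro: left_ideal_gen.intros)
next
  case (add u w)
  then show ?case by (simp add: distrib_left ann_ideal_add)
next
  case (mult u w)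
  then show ?case by (simp flip: mult.assoc)
qed

text \<open>
  The elements that are, modulo \<open>ann_ideal\<close>, sums of \<open>d\<close> creators times a proper element.
\<close>

inductive created :: "nat \<Rightarrow> ('m, 'n) env_gl \<Rightarrow> bool" where
  ann: "x \<in> ann_ideal \<Longrightarrow> created d x"
| proper: "u \<in> proper_env \<Longrightarrow> created 0 u"
| create: "created d x \<Longrightarrow> created (Suc d) (gl_gen (Virt \<alpha>) (Prop i) * x)"
| add: "created d x \<Longrightarrow> created d y \<Longrightarrow> created d (x + y)"

lemma created_uminus: "created d x \<Longrightarrow> created d (- x)"
proof (induction rule: created.induct)
  case (create d x \<alpha> i)
  then show ?case using created.create[of _ "- x"] by simp
next
  case (add d x y)
  then show ?case using created.add[of d "- x" "- y"] by simp
qed (auto intro: created.ann created.proper ann_ideal_uminus proper_env_uminus)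

lemma created_diff: "created d x \<Longrightarrow> created d y \<Longrightarrow> created d (x - y)"
  using created.add[OF _ created_uminus] by force

lemma created_0: "created d 0"
  by (simp add: created.ann ann_ideal_zero)

text \<open>
  The parts with \<open>e(i,j)\<close> and \<open>e(\<alpha>,\<beta>)\<close> have to be carried along, as these elements arise when
  \<open>e(i,\<beta>)\<close> passes a creator.
\<close>

lemma created_step:
  assumes "created d x"
  shows "created d (gl_gen (Prop i) (Prop j) * x) \<and> created d (gl_gen (Virt \<alpha>) (Virt \<beta>) * x)
    \<and> (case d of 0 \<Rightarrow> gl_gen (Prop i) (Virt \<beta>) * x \<in> ann_ideal
      | Suc d' \<Rightarrow> created d' (gl_gen (Prop i) (Virt \<beta>) * x))"
  using assms
proof (induction arbitrary: i j \<alpha> \<beta>)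
  case (ann x d)
  then show ?case by (auto simp: ann_ideal_mult created.ann split: nat.split)
next
  case (proper u)
  have "1 * gl_gen a (Virt \<beta>) * u \<in> ann_ideal" for a
    by (rule ann_ideal_proper_env[OF proper ann_ideal_gen])
  then show ?case
    using proper by (auto intro: created.ann created.proper proper_env.gen proper_env.mult)
next
  case (create d x \<gamma> k)
  let ?e = "gl_gen (Virt \<gamma>) (Prop k)"
  have "gl_gen (Prop i) (Prop j) * (?e * x)
      = ?e * (gl_gen (Prop i) (Prop j) * x) - (if i = k then gl_gen (Virt \<gamma>) (Prop j) * x else 0)"
    using gl_gen_commute[of "Prop i" "Prop j" "Virt \<gamma>" "Prop k"]
    by (simp add: gl_sign_def left_diff_distrib mult.assoc[symmetric])
  moreover have "gl_gen (Virt \<alpha>) (Virt \<beta>) * (?e * x)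
      = ?e * (gl_gen (Virt \<alpha>) (Virt \<beta>) * x) + (if \<beta> = \<gamma> then gl_gen (Virt \<alpha>) (Prop k) * x else 0)"
    using gl_gen_commute[of "Virt \<alpha>" "Virt \<beta>" "Virt \<gamma>" "Prop k"]
    by (simp add: gl_sign_def distrib_right mult.assoc[symmetric])
  moreover have "gl_gen (Prop i) (Virt \<beta>) * (?e * x)
      = (if \<beta> = \<gamma> then gl_gen (Prop i) (Prop k) * x else 0)
        + (if i = k then gl_gen (Virt \<gamma>) (Virt \<beta>) * x else 0)
        - ?e * (gl_gen (Prop i) (Virt \<beta>) * x)"
    using gl_gen_commute[of "Prop i" "Virt \<beta>" "Virt \<gamma>" "Prop k"]
    by (simp add: gl_sign_def env_const_uminus distrib_right left_diff_distrib mult.assoc[symmetric])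
  moreover have "created d (?e * (gl_gen (Prop i) (Virt \<beta>) * x))"
    using create.IH[of i _ _ \<beta>] by (cases d) (auto intro: created.ann created.create ann_ideal_mult)
  ultimately show ?case
    using create by (auto intro!: created_diff created.add created.create created_uminus simp: created_0)
next
  case (add d x y)
  then show ?case
    by (auto simp: distrib_left intro: created.add ann_ideal_add split: nat.splits)
qed

lemma created_zeroD:
  assumes "created 0 x"
  shows "\<exists>u\<in>proper_env. x - u \<in> ann_ideal"
  using assms
proof (induction "0 :: nat" x rule: created.induct)
  case (ann x)
  then show ?case using proper_env.const[of 0] by force
next
  case (proper u)
  then show ?case using ann_ideal_zero by force
next
  case (add x y)
  then obtain u w where "u \<in> proper_env" "w \<in> proper_env" "x - u \<in> ann_ideal" "y - w \<in> ann_ideal"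
    by auto
  then show ?case
    using ann_ideal_add[of "x - u" "y - w"] proper_env.add[of u w]
    by (intro bexI[of _ "u + w"]) (simp_all add: algebra_simps)
qed

lemma gl_prod_Nil [simp]: "gl_prod [] = 1"
  by (simp add: gl_prod_def)

lemma gl_prod_Cons [simp]: "gl_prod ((a, b) # w) = gl_gen a b * gl_prod w"
  by (simp add: gl_prod_def)

lemma gl_prod_append [simp]: "gl_prod (u @ w) = gl_prod u * gl_prod w"
  by (simp add: gl_prod_def)

definition creators :: "(('m, 'n) symb \<times> ('m, 'n) symb) set" where
  "creators = {(Virt \<alpha>, Prop i) | \<alpha> i. True}"

definition annihilators :: "(('m, 'n) symb \<times> ('m, 'n) symb) set" where
  "annihilators = {(Prop i, Virt \<alpha>) | \<alpha> i. True}"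

lemma created_creators: "set w \<subseteq> creators \<Longrightarrow> created (length w) (gl_prod w)"
proof (induction w)
  case Nil
  then show ?case using created.proper[OF proper_env.const[of 1]] by simp
next
  case (Cons p w)
  then show ?case by (auto simp: creators_def intro: created.create)
qed

lemma created_annihilators:
  "set w \<subseteq> annihilators \<Longrightarrow> created (length w + d) x \<Longrightarrow> created d (gl_prod w * x)"
proof (induction w arbitrary: d)
  case (Cons p w)
  then obtain i \<alpha> where p: "p = (Prop i, Virt \<alpha>)" by (auto simp: annihilators_def)
  have "created (Suc d) (gl_prod w * x)" using Cons by auto
  from created_step[OF this] show ?case by (simp add: p mult.assoc)
qed simp

lemma devirt_exists:
  assumes "set w \<subseteq> annihilators" "set w' \<subseteq> creators" "length w = length w'"
  obtains u where "u \<in> proper_env" "gl_prod w * gl_prod w' - u \<in> Irr"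
proof -
  have "created 0 (gl_prod w * gl_prod w')"
    using assms by (intro created_annihilators) (simp_all add: created_creators)
  from created_zeroD[OF this] show thesis
    using ann_ideal_subset_Irr that by blast
qed

section \<open>Rows of creation operators\<close>

lemma creators_anticommute:
  "gl_gen (Virt \<alpha>) (Prop i) * gl_gen (Virt \<beta>) (Prop j)
     = - (gl_gen (Virt \<beta>) (Prop j) * gl_gen (Virt \<alpha>) (Prop i))"
  using gl_gen_commute[of "Virt \<alpha>" "Prop i" "Virt \<beta>" "Prop j"]
  by (simp add: gl_sign_def env_const_uminus)

text \<open>
  The complex scalars contain \<open>1/2\<close>.
\<close>

lemma env_gl_eq_uminus: "x = - x \<Longrightarrow> x = (0 :: ('m, 'n) env_gl)"
proof -
  assume "x = - x"
  then have "x + x = 0" by (simp add: eq_neg_iff_add_eq_0)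
  then have "env_const (1/2) * x + env_const (1/2) * x = 0" by (simp flip: distrib_left)
  then have "env_const (1/2 + 1/2) * x = 0" unfolding env_const_add distrib_right .
  then show "x = 0" by simp
qed

lemma creator_square: "gl_gen (Virt \<alpha>) (Prop i) * gl_gen (Virt \<alpha>) (Prop i) = 0"
  using creators_anticommute by (rule env_gl_eq_uminus)

lemma creator_gl_prod:
  "set w \<subseteq> creators \<Longrightarrow>
     gl_gen (Virt \<alpha>) (Prop i) * gl_prod w = (- 1) ^ length w * (gl_prod w * gl_gen (Virt \<alpha>) (Prop i))"
proof (induction w)
  case (Cons p w)
  then obtain \<beta> j where p: "p = (Virt \<beta>, Prop j)" by (auto simp: creators_def)
  have "gl_gen (Virt \<alpha>) (Prop i) * gl_prod (p # w)
      = - (gl_gen (Virt \<beta>) (Prop j) * (gl_gen (Virt \<alpha>) (Prop i) * gl_prod w))"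
    by (simp add: p creators_anticommute[of \<alpha> i \<beta> j] mult.assoc flip: mult.assoc[of "gl_gen (Virt \<alpha>) (Prop i)"])
  also have "\<dots> = (- 1) ^ length (p # w) * (gl_prod (p # w) * gl_gen (Virt \<alpha>) (Prop i))"
    using Cons by (cases "even (length w)") (simp_all add: p mult.assoc)
  finally show ?case .
qed simp

lemma gl_prod_creators_swap:
  assumes "set u \<subseteq> creators" "set w \<subseteq> creators"
  shows "gl_prod u * gl_prod w = (- 1) ^ (length u * length w) * (gl_prod w * gl_prod u)"
  using assms(1)
proof (induction u)
  case (Cons p u)
  then obtain \<beta> j where p: "p = (Virt \<beta>, Prop j)" by (auto simp: creators_def)
  have IH: "gl_prod u * gl_prod w = (- 1) ^ (length u * length w) * (gl_prod w * gl_prod u)"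
    using Cons by simp
  have "gl_prod (p # u) * gl_prod w
      = (- 1) ^ (length u * length w) * (gl_gen (Virt \<beta>) (Prop j) * gl_prod w * gl_prod u)"
    unfolding p gl_prod_Cons mult.assoc IH
    by (cases "even (length u * length w)") (simp_all del: even_mult_iff)
  also have "\<dots> = (- 1) ^ (length (p # u) * length w) * (gl_prod w * gl_prod (p # u))"
    unfolding creator_gl_prod[OF assms(2)]
    by (simp add: p power_add mult.assoc)
      (cases "even (length u * length w)"; cases "even (length w)"; simp add: mult.assoc del: even_mult_iff)
  finally show ?case .
qed simp

definition row :: "'m \<Rightarrow> 'n list \<Rightarrow> ('m, 'n) env_gl" where
  "row \<beta> ks = gl_prod (map (\<lambda>k. (Virt \<beta>, Prop k)) ks)"

lemma row_Nil: "row \<beta> [] = 1"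
  by (simp add: row_def)

lemma row_Cons: "row \<beta> (k # ks) = gl_gen (Virt \<beta>) (Prop k) * row \<beta> ks"
  by (simp add: row_def)

lemma proper_creator:
  "gl_gen (Prop i) (Prop j) * gl_gen (Virt \<beta>) (Prop k)
     = gl_gen (Virt \<beta>) (Prop k) * gl_gen (Prop i) (Prop j)
       - (if i = k then gl_gen (Virt \<beta>) (Prop j) else 0)"
  using gl_gen_commute[of "Prop i" "Prop j" "Virt \<beta>" "Prop k"] by (simp add: gl_sign_def)

lemma proper_creator_mult:
  "gl_gen (Prop i) (Prop j) * (gl_gen (Virt \<beta>) (Prop k) * x)
     = gl_gen (Virt \<beta>) (Prop k) * (gl_gen (Prop i) (Prop j) * x)
       - (if i = k then gl_gen (Virt \<beta>) (Prop j) * x else 0)"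
  using arg_cong[OF proper_creator[of i j \<beta> k], of "\<lambda>y. y * x"]
  by (simp add: left_diff_distrib mult.assoc split: if_splits)

lemma row_proper_commute:
  "i \<notin> set ks \<Longrightarrow> gl_gen (Prop i) (Prop j) * row \<beta> ks = row \<beta> ks * gl_gen (Prop i) (Prop j)"
  by (induction ks) (auto simp: row_Nil row_Cons proper_creator_mult mult.assoc)

text \<open>
  \<open>e(i,i)\<close> counts the entries \<open>i\<close> with a minus sign, since \<open>i\<close> is the second index of the creators.
\<close>

lemma row_proper_diag:
  "gl_gen (Prop i) (Prop i) * row \<beta> ks
     = row \<beta> ks * gl_gen (Prop i) (Prop i) - of_nat (count_list ks i) * row \<beta> ks"
proof (induction ks)
  case (Cons k ks)
  have "gl_gen (Virt \<beta>) (Prop k) * (of_nat m * row \<beta> ks)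
      = of_nat m * (gl_gen (Virt \<beta>) (Prop k) * row \<beta> ks)" for m
    by (metis mult.assoc mult_of_nat_commute)
  then show ?case
    by (simp add: row_Cons proper_creator_mult Cons right_diff_distrib mult.assoc distrib_right)
qed (simp add: row_Nil)

lemma row_virtual_diag:
  "gl_gen (Virt \<beta>) (Virt \<beta>) * row \<beta> ks
     = row \<beta> ks * gl_gen (Virt \<beta>) (Virt \<beta>) + of_nat (length ks) * row \<beta> ks"
proof (induction ks)
  case (Cons k ks)
  have "gl_gen (Virt \<beta>) (Virt \<beta>) * gl_gen (Virt \<beta>) (Prop k)
      = gl_gen (Virt \<beta>) (Prop k) * gl_gen (Virt \<beta>) (Virt \<beta>) + gl_gen (Virt \<beta>) (Prop k)"
    using gl_gen_commute[of "Virt \<beta>" "Virt \<beta>" "Virt \<beta>" "Prop k"] by (simp add: gl_sign_def)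
  then have "gl_gen (Virt \<beta>) (Virt \<beta>) * row \<beta> (k # ks)
      = gl_gen (Virt \<beta>) (Prop k) * (gl_gen (Virt \<beta>) (Virt \<beta>) * row \<beta> ks) + row \<beta> (k # ks)"
    by (simp add: row_Cons distrib_right flip: mult.assoc)
  moreover have "gl_gen (Virt \<beta>) (Prop k) * (of_nat m * row \<beta> ks)
      = of_nat m * (gl_gen (Virt \<beta>) (Prop k) * row \<beta> ks)" for m
    by (metis mult.assoc mult_of_nat_commute)
  ultimately show ?case
    by (simp add: row_Cons Cons distrib_left distrib_right mult.assoc)
qed (simp add: row_Nil)

lemma creator_row_zero:
  "j \<in> set ks \<Longrightarrow> gl_gen (Virt \<beta>) (Prop j) * row \<beta> ks = 0"
proof (induction ks)
  case (Cons k ks)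
  show ?case
  proof (cases "j = k")
    case True
    then show ?thesis by (simp add: row_Cons creator_square flip: mult.assoc)
  next
    case False
    have "gl_gen (Virt \<beta>) (Prop j) * row \<beta> (k # ks)
        = - (gl_gen (Virt \<beta>) (Prop k) * (gl_gen (Virt \<beta>) (Prop j) * row \<beta> ks))"
      by (simp add: row_Cons creators_anticommute[of \<beta> j \<beta> k] flip: mult.assoc)
    then show ?thesis using False Cons by simp
  qed
qed simp

text \<open>
  All terms in which \<open>e(i,j)\<close> has replaced an entry \<open>i\<close> by \<open>j\<close> contain the creator of \<open>j\<close> twice.
\<close>

lemma creator_proper_row:
  assumes "i \<noteq> j"
  shows "gl_gen (Virt \<beta>) (Prop j) * (gl_gen (Prop i) (Prop j) * row \<beta> ks)
     = gl_gen (Virt \<beta>) (Prop j) * (row \<beta> ks * gl_gen (Prop i) (Prop j))"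
proof (induction ks)
  case (Cons k ks)
  let ?c = "\<lambda>k. gl_gen (Virt \<beta>) (Prop k)" and ?e = "gl_gen (Prop i) (Prop j)"
  have sq: "?c j * (?c j * x) = 0" for x
    by (simp add: creator_square flip: mult.assoc)
  have anti: "?c j * (?c k * x) = - (?c k * (?c j * x))" for x
    by (simp add: creators_anticommute[of \<beta> j \<beta> k] flip: mult.assoc)
  have "?c j * (?e * row \<beta> (k # ks)) = ?c j * (?c k * (?e * row \<beta> ks))"
    by (simp add: row_Cons proper_creator_mult right_diff_distrib sq)
  also have "\<dots> = ?c j * (row \<beta> (k # ks) * ?e)"
    by (simp add: row_Cons anti Cons mult.assoc)
  finally show ?case .
qed (simp add: row_Nil)

text \<open>
  Replacing \<open>i\<close> by \<open>j\<close> in a row that already contains \<open>j\<close> gives \<open>0\<close>.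
\<close>

lemma row_proper_commute_mem:
  assumes "i \<noteq> j" "j \<in> set ks"
  shows "gl_gen (Prop i) (Prop j) * row \<beta> ks = row \<beta> ks * gl_gen (Prop i) (Prop j)"
  using assms(2)
proof (induction ks)
  case (Cons k ks)
  show ?case
  proof (cases "k = j")
    case True
    then show ?thesis
      using assms(1) by (simp add: row_Cons proper_creator_mult creator_proper_row mult.assoc)
  next
    case False
    then show ?thesis
      using Cons by (simp add: row_Cons proper_creator_mult creator_row_zero mult.assoc)
  qed
qed simp

section \<open>The eigenvalue\<close>

lemma count_list_distinct: "distinct xs \<Longrightarrow> x \<in> set xs \<Longrightarrow> count_list xs x = 1"
  by (induction xs) (auto simp: count_list_0_iff)

locale env_module =
  fixes act :: "('m, 'n) env_gl \<Rightarrow> 'f::ab_group_add \<Rightarrow> 'f"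
  assumes act_add: "act (x + y) f = act x f + act y f"
    and act_add_right: "act x (f + g) = act x f + act x g"
    and act_mult: "act (x * y) f = act x (act y f)"
    and act_1: "act 1 f = f"
begin

lemma act_0: "act 0 f = 0"
  using act_add[of 0 0 f] by simp

lemma act_0_right: "act x 0 = 0"
  using act_add_right[of x 0 0] by simp

lemma act_uminus: "act (- x) f = - act x f"
  using act_add[of x "- x" f] by (simp add: act_0 eq_neg_iff_add_eq_0 add.commute)

lemma act_diff: "act (x - y) f = act x f - act y f"
  using act_add[of x "- y" f] by (simp add: act_uminus)

lemma act_const: "act x (act (env_const z) f) = act (env_const z) (act x f)"
  by (simp add: env_const_central flip: act_mult)

text \<open>
  \<open>f\<close> is a highest weight vector for the first \<open>l\<close> of the proper symbols \<open>s 1, s 2, \<dots>\<close>, of weight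
  \<open>\<nu>\<close>, and \<open>B\<close> consists of virtual symbols that do not occur in \<open>f\<close>: all \<open>e(a,\<beta>)\<close> kill it. Both \<open>l\<close> and \<open>B\<close> must be
  allowed to shrink: \<open>l\<close> is the length of the row peeled off, and each row uses up a virtual symbol.
\<close>

definition highest ::
  "(nat \<Rightarrow> 'n) \<Rightarrow> nat \<Rightarrow> 'm set \<Rightarrow> (nat \<Rightarrow> complex) \<Rightarrow> 'f \<Rightarrow> bool" where
  "highest s l B \<nu> f \<longleftrightarrow>
     (\<forall>a. \<forall>\<beta>\<in>B. act (gl_gen a (Virt \<beta>)) f = 0)
     \<and> (\<forall>j\<in>{1..l}. \<forall>i\<in>{1..<j}. act (gl_gen (Prop (s i)) (Prop (s j))) f = 0)
     \<and> (\<forall>i\<in>{1..l}. act (gl_gen (Prop (s i)) (Prop (s i))) f = act (env_const (\<nu> i)) f)"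

lemma highestD:
  assumes "highest s l B \<nu> f"
  shows "\<beta> \<in> B \<Longrightarrow> act (gl_gen a (Virt \<beta>)) f = 0"
    and "1 \<le> i \<Longrightarrow> i < j \<Longrightarrow> j \<le> l \<Longrightarrow> act (gl_gen (Prop (s i)) (Prop (s j))) f = 0"
    and "1 \<le> i \<Longrightarrow> i \<le> l \<Longrightarrow> act (gl_gen (Prop (s i)) (Prop (s i))) f = act (env_const (\<nu> i)) f"
  using assms by (auto simp: highest_def)

lemma annihilator_row_zero:
  assumes "\<And>a. act (gl_gen a (Virt \<beta>)) f = 0" "\<beta> \<noteq> \<gamma>"
  shows "act (gl_gen a (Virt \<beta>)) (act (row \<gamma> ks) f) = 0"
proof (induction ks arbitrary: a)
  case Nil
  then show ?case by (simp add: row_Nil act_1 assms)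
next
  case (Cons k ks)
  have "gl_gen a (Virt \<beta>) * row \<gamma> (k # ks)
      = env_const (gl_sign a (Virt \<beta>) (Virt \<gamma>) (Prop k)) * gl_gen (Virt \<gamma>) (Prop k)
          * (gl_gen a (Virt \<beta>) * row \<gamma> ks)
       - env_const (gl_sign a (Virt \<beta>) (Virt \<gamma>) (Prop k))
          * (if a = Prop k then gl_gen (Virt \<gamma>) (Virt \<beta>) * row \<gamma> ks else 0)"
    using gl_gen_commute[of a "Virt \<beta>" "Virt \<gamma>" "Prop k"] assms(2)
    by (simp add: row_Cons left_diff_distrib mult.assoc[symmetric])
  from arg_cong[OF this, of "\<lambda>x. act x f"] show ?case
    by (simp add: act_mult act_diff act_0 act_0_right Cons split: if_splits)
qed

text \<open>
  Passing the creator of an entry \<open>j\<close> leaves \<open>e(i,j)\<close>, which commutes with the rest of the row and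
  kills \<open>f\<close>.
\<close>

lemma annihilator_row_absent:
  assumes "i \<notin> set ks" "\<And>j. j \<in> set ks \<Longrightarrow> act (gl_gen (Prop i) (Prop j)) f = 0"
    and "act (gl_gen (Prop i) (Virt \<beta>)) f = 0"
  shows "act (gl_gen (Prop i) (Virt \<beta>)) (act (row \<beta> ks) f) = 0"
  using assms(1,2)
proof (induction ks)
  case Nil
  then show ?case by (simp add: row_Nil act_1 assms(3))
next
  case (Cons k ks)
  have "gl_gen (Prop i) (Virt \<beta>) * row \<beta> (k # ks)
      = gl_gen (Prop i) (Prop k) * row \<beta> ks
        - gl_gen (Virt \<beta>) (Prop k) * (gl_gen (Prop i) (Virt \<beta>) * row \<beta> ks)"
    using gl_gen_commute[of "Prop i" "Virt \<beta>" "Virt \<beta>" "Prop k"] Cons.prems(1)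
    by (simp add: row_Cons left_diff_distrib gl_sign_def env_const_uminus flip: mult.assoc)
  also have "gl_gen (Prop i) (Prop k) * row \<beta> ks = row \<beta> ks * gl_gen (Prop i) (Prop k)"
    using Cons.prems(1) by (simp add: row_proper_commute)
  finally show ?case
    using Cons by (simp add: act_diff act_0_right flip: act_mult) (simp add: act_mult act_0_right)
qed

text \<open>
  The annihilator of \<open>k\<close> and the leading creator leave \<open>e(k,k) + e(\<beta>,\<beta>)\<close>. The first summand commutes
  with the rest of the row and reads off the weight of \<open>f\<close>; the second counts the rest of the row.
\<close>

lemma annihilator_row_head:
  assumes "k \<notin> set ks" "\<And>j. j \<in> set ks \<Longrightarrow> act (gl_gen (Prop k) (Prop j)) f = 0"
    and ann: "\<And>a. act (gl_gen a (Virt \<beta>)) f = 0"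
    and wt: "act (gl_gen (Prop k) (Prop k)) f = act (env_const z) f"
  shows "act (gl_gen (Prop k) (Virt \<beta>)) (act (row \<beta> (k # ks)) f)
    = act (env_const (z + of_nat (length ks))) (act (row \<beta> ks) f)"
proof -
  have "gl_gen (Prop k) (Virt \<beta>) * row \<beta> (k # ks)
      = gl_gen (Prop k) (Prop k) * row \<beta> ks + gl_gen (Virt \<beta>) (Virt \<beta>) * row \<beta> ks
        - gl_gen (Virt \<beta>) (Prop k) * (gl_gen (Prop k) (Virt \<beta>) * row \<beta> ks)"
    using gl_gen_commute[of "Prop k" "Virt \<beta>" "Virt \<beta>" "Prop k"]
    by (simp add: row_Cons left_diff_distrib distrib_right gl_sign_def env_const_uminus flip: mult.assoc)
  also have "\<dots> = row \<beta> ks * gl_gen (Prop k) (Prop k)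
      + (row \<beta> ks * gl_gen (Virt \<beta>) (Virt \<beta>) + of_nat (length ks) * row \<beta> ks)
        - gl_gen (Virt \<beta>) (Prop k) * (gl_gen (Prop k) (Virt \<beta>) * row \<beta> ks)"
    using assms(1) by (simp add: row_proper_commute row_virtual_diag)
  finally have "gl_gen (Prop k) (Virt \<beta>) * row \<beta> (k # ks) = \<dots>" .
  from arg_cong[OF this, of "\<lambda>x. act x f"]
  have "act (gl_gen (Prop k) (Virt \<beta>)) (act (row \<beta> (k # ks)) f)
      = act (row \<beta> ks) (act (env_const z) f) + act (of_nat (length ks)) (act (row \<beta> ks) f)"
    by (simp only: act_mult act_add act_diff wt ann act_0_right
        annihilator_row_absent[OF assms(1,2) ann]) simp
  also have "\<dots> = act (env_const (z + of_nat (length ks))) (act (row \<beta> ks) f)"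
    by (simp only: act_const[of "row _ _"] env_const_add act_add env_const_of_nat)
  finally show ?thesis .
qed

text \<open>
  The annihilators \<open>e(s 1,\<beta>), \<dots>, e(s q,\<beta>)\<close> consume the first \<open>q\<close> creators of the row one after the
  other. For \<open>q = l\<close> this is the Capelli identity for one row.
\<close>

lemma row_contraction:
  assumes "highest s l B \<nu> f" "\<beta> \<in> B" "inj_on s {1..l}" "q \<le> l"
  shows "act (gl_prod (map (\<lambda>k. (Prop k, Virt \<beta>)) (map s (rev [1..<Suc q]))))
      (act (row \<beta> (map s [1..<Suc l])) f)
    = act (env_const (\<Prod>k=1..q. \<nu> k + of_nat l - of_nat k)) (act (row \<beta> (map s [Suc q..<Suc l])) f)"
  using assms(4)
proof (induction q)
  case 0
  then show ?case by (simp add: act_1)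
next
  case (Suc q)
  let ?e = "gl_gen (Prop (s (Suc q))) (Virt \<beta>)"
  let ?d = "\<lambda>q. gl_prod (map (\<lambda>k. (Prop k, Virt \<beta>)) (map s (rev [1..<Suc q])))"
  let ?c = "\<lambda>q. \<Prod>k=1..q. \<nu> k + of_nat l - of_nat k"
  let ?R = "\<lambda>q. row \<beta> (map s [Suc q..<Suc l])"
  have "?d (Suc q) = ?e * ?d q" by simp
  then have "act (?d (Suc q)) (act (row \<beta> (map s [1..<Suc l])) f) = act ?e (act (env_const (?c q)) (act (?R q) f))"
    using Suc by (simp only: act_mult)
  also have "\<dots> = act (env_const (?c q)) (act ?e (act (?R q) f))"
    by (rule act_const)
  also have "act ?e (act (?R q) f) = act (env_const (\<nu> (Suc q) + of_nat l - of_nat (Suc q))) (act (?R (Suc q)) f)"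
  proof -
    let ?ks = "map s [Suc (Suc q)..<Suc l]"
    have R: "map s [Suc q..<Suc l] = s (Suc q) # ?ks"
      using Suc.prems by (simp add: upt_conv_Cons del: upt_Suc)
    have "act ?e (act (row \<beta> (s (Suc q) # ?ks)) f)
        = act (env_const (\<nu> (Suc q) + of_nat (length ?ks))) (act (row \<beta> ?ks) f)"
    proof (rule annihilator_row_head)
      show "s (Suc q) \<notin> set ?ks"
      proof
        assume "s (Suc q) \<in> set ?ks"
        then obtain k where "s (Suc q) = s k" "Suc (Suc q) \<le> k" "k \<le> l"
          by (auto simp del: upt_Suc)
        then show False
          using inj_onD[OF assms(3), of "Suc q" k] by simp
      qed
      show "act (gl_gen (Prop (s (Suc q))) (Prop j)) f = 0" if j: "j \<in> set ?ks" for j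
      proof -
        obtain k where "j = s k" "Suc q < k" "k \<le> l"
          using j by (auto simp del: upt_Suc)
        then show ?thesis using highestD(2)[OF assms(1), of "Suc q" k] by simp
      qed
      show "act (gl_gen a (Virt \<beta>)) f = 0" for a
        using assms(2) by (rule highestD(1)[OF assms(1)])
      show "act (gl_gen (Prop (s (Suc q))) (Prop (s (Suc q)))) f = act (env_const (\<nu> (Suc q))) f"
        using Suc.prems by (intro highestD(3)[OF assms(1)]) auto
    qed
    moreover have "\<nu> (Suc q) + of_nat (length ?ks) = \<nu> (Suc q) + of_nat l - of_nat (Suc q)"
      using Suc.prems by (simp del: upt_Suc of_nat_Suc add: of_nat_diff)
    ultimately show ?thesis unfolding R by (simp only:)
  qed
  also have "act (env_const (?c q)) \<dots> = act (env_const (?c (Suc q))) (act (?R (Suc q)) f)"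
  proof -
    have "?c (Suc q) = ?c q * (\<nu> (Suc q) + of_nat l - of_nat (Suc q))"
      by (simp del: of_nat_Suc)
    then show ?thesis by (simp only: env_const_mult act_mult)
  qed
  finally show ?case .
qed

text \<open>
  A row containing the symbols \<open>s 1, \<dots>, s l\<close> once each commutes with the raising operators among them
  and lowers each of their weights by \<open>1\<close>.
\<close>

lemma highest_row:
  assumes "highest s l B \<nu> f" "l \<le> x" "\<gamma> \<notin> B" "inj_on s {1..x}"
  shows "highest s l B (\<lambda>i. \<nu> i - 1) (act (row \<gamma> (map s [1..<Suc x])) f)"
  unfolding highest_def
proof (intro conjI ballI allI)
  let ?ks = "map s [1..<Suc x]"
  show "act (gl_gen a (Virt \<beta>)) (act (row \<gamma> ?ks) f) = 0" if "\<beta> \<in> B" for a \<beta>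
    using that assms(3) by (intro annihilator_row_zero highestD(1)[OF assms(1)]) auto
  show "act (gl_gen (Prop (s i)) (Prop (s j))) (act (row \<gamma> ?ks) f) = 0"
    if "j \<in> {1..l}" "i \<in> {1..<j}" for i j
  proof -
    have "s i \<noteq> s j"
      using inj_onD[OF assms(4), of i j] assms(2) that by auto
    moreover have "s j \<in> set ?ks"
      using assms(2) that by (auto simp del: upt_Suc)
    ultimately show ?thesis
      using row_proper_commute_mem[of "s i" "s j" ?ks \<gamma>] highestD(2)[OF assms(1), of i j] that
      by (simp add: act_0_right act_mult[symmetric] del: upt_Suc) (simp add: act_mult act_0_right del: upt_Suc)
  qed
  show "act (gl_gen (Prop (s i)) (Prop (s i))) (act (row \<gamma> ?ks) f)
      = act (env_const (\<nu> i - 1)) (act (row \<gamma> ?ks) f)" if "i \<in> {1..l}" for i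
  proof -
    have "distinct ?ks" "s i \<in> set ?ks"
      using assms(2,4) that by (auto simp: distinct_map atLeastLessThanSuc_atLeastAtMost simp del: upt_Suc)
    then have "count_list ?ks (s i) = 1"
      by (rule count_list_distinct)
    then have "gl_gen (Prop (s i)) (Prop (s i)) * row \<gamma> ?ks
        = row \<gamma> ?ks * gl_gen (Prop (s i)) (Prop (s i)) - row \<gamma> ?ks"
      using row_proper_diag[of "s i" \<gamma> ?ks] by (simp del: upt_Suc)
    from arg_cong[OF this, of "\<lambda>y. act y f"] show ?thesis
      using highestD(3)[OF assms(1), of i] that
      by (simp add: act_mult act_diff act_const env_const_diff act_1 del: upt_Suc)
  qed
qed

definition up_word ::
  "(nat \<Rightarrow> 'm) \<Rightarrow> (nat \<Rightarrow> 'n) \<Rightarrow> nat list \<Rightarrow> (('m, 'n) symb \<times> ('m, 'n) symb) list" where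
  "up_word \<alpha> s lam = concat
     (map (\<lambda>i. map (\<lambda>t. (Virt (\<alpha> i), Prop t)) (map s [1..<Suc (lam ! i)])) [0..<length lam])"

definition down_word ::
  "(nat \<Rightarrow> 'm) \<Rightarrow> (nat \<Rightarrow> 'n) \<Rightarrow> nat list \<Rightarrow> (('m, 'n) symb \<times> ('m, 'n) symb) list" where
  "down_word \<alpha> s lam = concat
     (map (\<lambda>i. map (\<lambda>t. (Prop t, Virt (\<alpha> i))) (map s (rev [1..<Suc (lam ! i)]))) [0..<length lam])"

lemma up_word_snoc:
  "up_word \<alpha> s (lam @ [l]) = up_word \<alpha> s lam @ map (\<lambda>t. (Virt (\<alpha> (length lam)), Prop t)) (map s [1..<Suc l])"
  by (auto simp: up_word_def nth_append upt_Suc[of 0 "length lam"] simp del: upt_Suc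
      intro!: arg_cong[of _ _ concat])

lemma down_word_snoc:
  "down_word \<alpha> s (lam @ [l])
     = down_word \<alpha> s lam @ map (\<lambda>t. (Prop t, Virt (\<alpha> (length lam)))) (map s (rev [1..<Suc l]))"
  by (auto simp: down_word_def nth_append upt_Suc[of 0 "length lam"] simp del: upt_Suc
      intro!: arg_cong[of _ _ concat])

lemma length_up_word: "length (up_word \<alpha> s lam) = (\<Sum>j<length lam. lam ! j)"
proof -
  have "length (up_word \<alpha> s lam) = sum_list lam"
    by (induction lam rule: rev_induct) (simp_all add: up_word_snoc del: upt_Suc, simp add: up_word_def)
  then show ?thesis by (simp add: sum_list_sum_nth atLeast0LessThan)
qed

lemma set_up_word: "set (up_word \<alpha> s lam) \<subseteq> creators"
  by (auto simp: up_word_def creators_def)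

lemma length_down_word: "length (down_word \<alpha> s lam) = (\<Sum>j<length lam. lam ! j)"
proof -
  have "length (down_word \<alpha> s lam) = sum_list lam"
    by (induction lam rule: rev_induct) (simp_all add: down_word_snoc del: upt_Suc, simp add: down_word_def)
  then show ?thesis by (simp add: sum_list_sum_nth atLeast0LessThan)
qed

lemma set_down_word: "set (down_word \<alpha> s lam) \<subseteq> annihilators"
  by (auto simp: down_word_def annihilators_def)

lemma highest_up_word:
  assumes "highest s l B \<nu> f" "\<forall>x\<in>set lam. l \<le> x \<and> x \<le> n" "\<alpha> ` {..<length lam} \<inter> B = {}" "inj_on s {1..n}"
  shows "highest s l B (\<lambda>i. \<nu> i - of_nat (length lam)) (act (gl_prod (up_word \<alpha> s lam)) f)"
  using assms(1-3)
proof (induction lam arbitrary: f \<nu> rule: rev_induct)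
  case Nil
  then show ?case by (simp add: up_word_def act_1)
next
  case (snoc x lam)
  let ?f = "act (row (\<alpha> (length lam)) (map s [1..<Suc x])) f"
  have B: "\<alpha> (length lam) \<notin> B" "\<alpha> ` {..<length lam} \<inter> B = {}"
    using snoc.prems(3) by (simp_all add: lessThan_Suc)
  have "highest s l B (\<lambda>i. \<nu> i - 1) ?f"
    using B snoc.prems(1,2) inj_on_subset[OF assms(4), of "{1..x}"] by (intro highest_row) auto
  then have "highest s l B (\<lambda>i. \<nu> i - 1 - of_nat (length lam)) (act (gl_prod (up_word \<alpha> s lam)) ?f)"
    using B snoc.prems(2) by (intro snoc.IH) auto
  then show ?case
    by (simp add: up_word_snoc act_mult row_def diff_diff_eq del: upt_Suc)
qed

definition deruyts_factor :: "nat list \<Rightarrow> (nat \<Rightarrow> complex) \<Rightarrow> complex" where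
  "deruyts_factor lam \<nu> = (- 1) ^ (\<Sum>i<length lam. lam ! i * (\<Sum>j<i. lam ! j))
     * (\<Prod>i=1..length lam. \<Prod>k=1..lam ! (i - 1). \<nu> k - of_nat i + of_nat (lam ! (i - 1)) - of_nat k + 1)"

lemma deruyts_factor_snoc:
  "deruyts_factor (lam @ [l]) \<nu> = (- 1) ^ ((\<Sum>j<length lam. lam ! j) * l)
     * (\<Prod>k=1..l. \<nu> k - of_nat (length lam) + of_nat l - of_nat k) * deruyts_factor lam \<nu>"
proof -
  let ?S = "\<lambda>lam :: nat list. \<Sum>i<length lam. lam ! i * (\<Sum>j<i. lam ! j)"
  let ?h = "\<lambda>(lam :: nat list) i. \<Prod>k=1..lam ! (i - 1).
    \<nu> k - of_nat i + of_nat (lam ! (i - 1)) - of_nat k + 1"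
  have "(\<Sum>i<length lam. (lam @ [l]) ! i * (\<Sum>j<i. (lam @ [l]) ! j)) = ?S lam"
    by (intro sum.cong refl arg_cong2[of _ _ _ _ "(*)"]) (auto simp: nth_append)
  moreover have "(\<Sum>j<length lam. (lam @ [l]) ! j) = (\<Sum>j<length lam. lam ! j)"
    by (intro sum.cong refl) (auto simp: nth_append)
  ultimately have S: "?S (lam @ [l]) = ?S lam + (\<Sum>j<length lam. lam ! j) * l"
    by (simp add: mult.commute)
  have "?h (lam @ [l]) (Suc (length lam)) = (\<Prod>k=1..l. \<nu> k - of_nat (length lam) + of_nat l - of_nat k)"
    by (simp add: algebra_simps)
  moreover have "(\<Prod>i=1..length lam. ?h (lam @ [l]) i) = (\<Prod>i=1..length lam. ?h lam i)"
    by (intro prod.cong refl) (auto simp: nth_append)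
  moreover have "{1..length (lam @ [l])} = insert (Suc (length lam)) {1..length lam}"
    by auto
  ultimately have P: "(\<Prod>i=1..length (lam @ [l]). ?h (lam @ [l]) i)
      = (\<Prod>k=1..l. \<nu> k - of_nat (length lam) + of_nat l - of_nat k) * (\<Prod>i=1..length lam. ?h lam i)"
    by (simp only: prod.insert finite_atLeastAtMost) simp
  show ?thesis
    unfolding deruyts_factor_def S P power_add by (simp only: mult_ac)
qed

text \<open>
  Induction on the number of rows, removing the last one; its length \<open>l\<close> is at most that of the other
  rows, so that these preserve highest weight vectors for the first \<open>l\<close> symbols.
\<close>

lemma capelli_deruyts_word:
  assumes "highest s n UNIV \<nu> f" "inj_on s {1..n}" "is_partition lam" "\<forall>x\<in>set lam. x \<le> n"
    "inj_on \<alpha> {..<length lam}"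
  shows "act (gl_prod (down_word \<alpha> s lam) * gl_prod (up_word \<alpha> s lam)) f
    = act (env_const (deruyts_factor lam \<nu>)) f"
  using assms(3-5)
proof (induction lam rule: rev_induct)
  case Nil
  then show ?case by (simp add: up_word_def down_word_def deruyts_factor_def)
next
  case (snoc l lam)
  let ?\<beta> = "\<alpha> (length lam)" and ?ks = "map s [1..<Suc l]"
  let ?C = "gl_prod (map (\<lambda>t. (Prop t, Virt ?\<beta>)) (map s (rev [1..<Suc l])))"
  let ?c = "\<Prod>k=1..l. \<nu> k - of_nat (length lam) + of_nat l - of_nat k"
  let ?sgn = "(- 1 :: complex) ^ ((\<Sum>j<length lam. lam ! j) * l)"
  define g where "g = act (gl_prod (up_word \<alpha> s lam)) f"
  have part: "is_partition lam" "\<forall>x\<in>set lam. l \<le> x \<and> x \<le> n" and l: "l \<le> n"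
    using snoc.prems by (auto simp: is_partition_def sorted_wrt_append)
  have inj: "inj_on \<alpha> {..<length lam}" "\<alpha> ` {..<length lam} \<inter> {?\<beta>} = {}"
    using snoc.prems(3) by (auto simp: lessThan_Suc)
  have IH: "act (gl_prod (down_word \<alpha> s lam)) g = act (env_const (deruyts_factor lam \<nu>)) f"
    using snoc.IH[OF part(1) _ inj(1)] part(2) by (simp add: act_mult g_def)
  have "highest s l {?\<beta>} \<nu> f"
    using assms(1) l by (auto simp: highest_def)
  then have "highest s l {?\<beta>} (\<lambda>i. \<nu> i - of_nat (length lam)) g"
    unfolding g_def by (intro highest_up_word[OF _ part(2) inj(2) assms(2)])
  then have "act ?C (act (row ?\<beta> ?ks) g)
      = act (env_const (\<Prod>k=1..l. \<nu> k - of_nat (length lam) + of_nat l - of_nat k))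
          (act (row ?\<beta> (map s [Suc l..<Suc l])) g)"
    by (rule row_contraction) (use inj_on_subset[OF assms(2), of "{1..l}"] l in auto)
  then have row: "act ?C (act (row ?\<beta> ?ks) g) = act (env_const ?c) g"
    by (simp add: row_Nil act_1)
  (* The last row of creators has to act next to its own annihilators. *)
  have "gl_prod (up_word \<alpha> s (lam @ [l])) = env_const ?sgn * (row ?\<beta> ?ks * gl_prod (up_word \<alpha> s lam))"
    unfolding up_word_snoc gl_prod_append
    by (subst gl_prod_creators_swap[OF set_up_word])
      (auto simp: creators_def row_def length_up_word env_const_power env_const_uminus simp del: upt_Suc)
  then have "act (gl_prod (down_word \<alpha> s (lam @ [l])) * gl_prod (up_word \<alpha> s (lam @ [l]))) f
      = act (env_const ?sgn) (act (gl_prod (down_word \<alpha> s lam)) (act ?C (act (row ?\<beta> ?ks) g)))"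
    by (simp only: down_word_snoc gl_prod_append act_mult act_const[of _ ?sgn] g_def)
  also have "\<dots> = act (env_const ?sgn) (act (env_const ?c) (act (env_const (deruyts_factor lam \<nu>)) f))"
    unfolding row act_const[of "gl_prod (down_word \<alpha> s lam)" ?c] IH ..
  also have "\<dots> = act (env_const (deruyts_factor (lam @ [l]) \<nu>)) f"
    by (simp only: deruyts_factor_snoc env_const_mult act_mult)
  finally show ?case .
qed

end

lemma proper_sym_less:
  assumes "1 \<le> i" "i < j" "j \<le> CARD('n)"
  shows "proper_sym i < (proper_sym j :: 'n::{finite, linorder})"
proof -
  have "sorted_wrt (<) (sorted_list_of_set (UNIV :: 'n set))"
    by (simp add: strict_sorted_iff)
  then show ?thesis
    unfolding proper_sym_def using assms by (elim sorted_wrt_nth_less) auto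
qed

theorem proposition5:
  fixes scl :: "complex \<Rightarrow> 'v::ab_group_add \<Rightarrow> 'v"
    and \<rho> :: "complex^'n::{finite, linorder}^'n::{finite, linorder} \<Rightarrow> 'v \<Rightarrow> 'v"
    and \<mu> :: "'n \<Rightarrow> nat"
    and v :: 'v
    and lam :: "nat list"
    and \<alpha> :: "nat \<Rightarrow> 'm::finite"
  assumes "is_partition lam" and "lam \<noteq> []" and "hd lam \<le> CARD('n)"
    and "gl_module scl \<rho>"
    and "antimono \<mu>"
    and "highest_weight_vector scl \<rho> (\<lambda>i. of_nat (\<mu> i)) v"
    and "inj_on \<alpha> {..<length lam}"
  shows "env_action scl \<rho> (capelli_deruyts \<alpha> lam) v =
    scl
      ((- 1) ^ (\<Sum>i<length lam. lam ! i * (\<Sum>j<i. lam ! j))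
       * (\<Prod>i=1..length lam. \<Prod>k=1..lam ! (i - 1).
            of_nat (\<mu> (proper_sym k)) - of_nat i + of_nat (lam ! (i - 1)) - of_nat k + 1))
      v"
proof -
  interpret gl_module scl \<rho> by fact
  interpret fock scl "\<lambda>i j. Endo (\<rho> (elem_matrix i j))" "TYPE('m)"
    by (rule fock_gl_module)
  interpret env_module "\<lambda>x f. app (env_val x) f"
  proof
    have "env_val (env_const 1) = 1" by (simp only: env_val_const scal_1)
    then show "app (env_val 1) f = f" for f by simp
  qed (simp_all add: env_val_add env_val_mult app_add)
  have r: "app (Endo (\<rho> (elem_matrix i j))) w = \<rho> (elem_matrix i j) w" for i j w
    by (simp add: app_Endo action_linear)
  let ?X = "gl_prod (down_word \<alpha> proper_sym lam) * gl_prod (up_word \<alpha> proper_sym lam) :: ('m, 'n) env_gl"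
  let ?\<nu> = "\<lambda>k. of_nat (\<mu> (proper_sym k)) :: complex"
  obtain u where u: "u \<in> proper_env" "?X - u \<in> Irr"
    by (rule devirt_exists[OF set_down_word set_up_word]) (simp_all add: length_down_word length_up_word)
  have "capelli_deruyts \<alpha> lam = devirt ?X"
    unfolding capelli_deruyts_def capelli_bitableau_def up_word_def down_word_def
    by (intro arg_cong[of _ _ devirt] arg_cong2[of _ _ _ _ "(*)"] arg_cong[of _ _ gl_prod]
        arg_cong[of _ _ concat] map_cong) (auto simp del: upt_Suc)
  also have "\<dots> = u" using u by (rule devirt_eqI)
  finally have K: "capelli_deruyts \<alpha> lam = u" .
  have hw: "\<rho> (elem_matrix i i) v = scl (of_nat (\<mu> i)) v" "i < j \<Longrightarrow> \<rho> (elem_matrix i j) v = 0" for i j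
    using assms(6) by (auto simp: highest_weight_vector_def)
  have "highest proper_sym CARD('n) UNIV ?\<nu> (vac v)"
    unfolding highest_def
    by (auto simp: env_val_gen env_val_const E_Virt_vac E_Prop_vac scal_vac r hw proper_sym_less vac_0
        simp del: E.simps)
  moreover have "inj_on (proper_sym :: nat \<Rightarrow> 'n) {1..CARD('n)}"
    using proper_sym_less by (intro linorder_inj_onI) (fastforce simp: less_imp_neq)+
  moreover have "\<forall>x\<in>set lam. x \<le> CARD('n)"
    using assms(1-3) by (cases lam) (auto simp: is_partition_def)
  ultimately have "app (env_val ?X) (vac v) = app (env_val (env_const (deruyts_factor lam ?\<nu>))) (vac v)"
    using assms(1,7) by (intro capelli_deruyts_word)
  also have "\<dots> = vac (scl (deruyts_factor lam ?\<nu>) v)"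
    by (simp add: env_val_const scal_vac)
  finally have X: "app (env_val ?X) (vac v) = vac (scl (deruyts_factor lam ?\<nu>) v)" .
  have "app (env_val u) (vac v) = app (env_val ?X) (vac v)"
    using Irr_vac[OF u(2), of v] by (simp add: act_diff)
  moreover have "app (env_val u) (vac v) = vac (env_action scl \<rho> u v)"
    using r u(1) by (rule env_action_vac)
  ultimately show ?thesis
    unfolding K by (simp add: X vac_inject deruyts_factor_def)
qed

end
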